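(* Let $k$ be an algebraically closed field of characteristic $0$ and let $a,b\in k$ satisfy $(4a^3+27-18ab-a^2b^2+4b^3)(b^3-27)\neq0$. Put $F=X^3+aX^2+bX+1$, $G=4X^3+b^2X^2+2bX+1$, let $K=k(X,Y)$ with $Y^2=F(X)G(X)$, and let $E_1,E_2$ be the degree $3$ elliptic subfields of $K$ described in the context. Put $u=ab$, $v=b^3$ and assume $v\ne 0$. If $E_1\cong E_2$, then $$8v^3+27v^2-54uv^2-u^2v^2+108u^2v+4u^3v-108u^3=0$$ or $$\begin{aligned} &324v^4u^2-5832v^4u+37908v^4-314928v^3u-81v^3u^4+255879v^3+30618v^3u^2\\ &-864v^3u^3-6377292uv^2+8503056v^2-324u^5v^2+2125764u^2v^2-215784u^3v^2\\ &+14580u^4v^2+16u^6v^2+78732u^3v+8748u^5v-864u^6v-157464u^4v+11664u^6=0 . \end{aligned}$$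
   Context: $E_1=k(U_1,V_1)$ with $U_1=X^2/F(X)$, $V_1=Y(X^3-bX-2)/F(X)^2$. $E_2=k(U_2,V_2)$ where: if $b(b^3-4ab+9)\neq0$, $U_2=(X-s)^2(X-t)/G(X)$ with $s=-3/b$, $t=(3a-b^2)/(b^3-4ab+9)$, and $V_2=\sqrt{27-b^3}\,Y\big((4ab-8-b^3)X^3-(b^2-4a)X^2+bX+1\big)/G(X)^2$; if $b^3-4ab+9=0$, $U_2=(bX+3)^2/(b^2G(X))$ and $V_2=\frac8b\sqrt b\,Y(bX^3+9X^2+b^2X+b)/G(X)^2$. Each $E_i$ has genus $1$ and $[K:E_i]=3$. $E_1\cong E_2$ means that they have equal $j$-invariants. *)

theory Defs
  imports "HOL-Computational_Algebra.Computational_Algebra"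
begin

text \<open>The base field \<open>k\<close> is a type; an extension field is a type \<open>'f\<close> together with an
  embedding \<open>\<iota>\<close> of \<open>k\<close>. Function fields over \<open>k\<close> are subsets of \<open>'f\<close>.\<close>

definition field_embedding :: "('k::field \<Rightarrow> 'f::field) \<Rightarrow> bool" where
  "field_embedding \<iota> \<longleftrightarrow>
     \<iota> 1 = 1 \<and> (\<forall>x y. \<iota> (x + y) = \<iota> x + \<iota> y) \<and> (\<forall>x y. \<iota> (x * y) = \<iota> x * \<iota> y)"

definition is_subfield :: "'f::field set \<Rightarrow> bool" where
  "is_subfield L \<longleftrightarrow>
     1 \<in> L \<and> (\<forall>x\<in>L. \<forall>y\<in>L. x - y \<in> L \<and> x * y \<in> L) \<and> (\<forall>x\<in>L. inverse x \<in> L)"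

text \<open>\<open>adjoin \<iota> S\<close> is \<open>k(S)\<close>.\<close>

definition adjoin :: "('k::field \<Rightarrow> 'f::field) \<Rightarrow> 'f set \<Rightarrow> 'f set" where
  "adjoin \<iota> S = is_subfield hull (range \<iota> \<union> S)"

definition eval_at :: "('k::field \<Rightarrow> 'f::field) \<Rightarrow> 'k poly \<Rightarrow> 'f \<Rightarrow> 'f" where
  "eval_at \<iota> p x = poly (map_poly \<iota> p) x"

definition transcendental_over :: "('k::field \<Rightarrow> 'f::field) \<Rightarrow> 'f \<Rightarrow> bool" where
  "transcendental_over \<iota> x \<longleftrightarrow> (\<forall>p. p \<noteq> 0 \<longrightarrow> eval_at \<iota> p x \<noteq> 0)"

text \<open>\<open>E\<close> is the function field over \<open>k\<close> of the elliptic curve \<open>y\<^sup>2 = x\<^sup>3 + A x + B\<close>. In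
  characteristic \<open>0\<close> and over an algebraically closed \<open>k\<close>, every function field of genus
  \<open>1\<close> has such a model.\<close>

definition weierstrass_model ::
  "('k::field \<Rightarrow> 'f::field) \<Rightarrow> 'f set \<Rightarrow> 'k \<Rightarrow> 'k \<Rightarrow> bool" where
  "weierstrass_model \<iota> E A B \<longleftrightarrow>
     4 * A ^ 3 + 27 * B ^ 2 \<noteq> 0 \<and>
     (\<exists>x y. transcendental_over \<iota> x \<and> y ^ 2 = eval_at \<iota> [:B, A, 0, 1:] x \<and>
            E = adjoin \<iota> {x, y})"

text \<open>The \<open>j\<close>-invariant of a function field of genus \<open>1\<close>: all its Weierstrass models have
  the same \<open>j\<close>, so the description is definite.\<close>

definition j_invariant :: "('k::field \<Rightarrow> 'f::field) \<Rightarrow> 'f set \<Rightarrow> 'k" where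
  "j_invariant \<iota> E =
     (THE j. \<exists>A B. weierstrass_model \<iota> E A B \<and>
                   j = 1728 * (4 * A ^ 3) / (4 * A ^ 3 + 27 * B ^ 2))"

definition F_poly :: "'k::field \<Rightarrow> 'k \<Rightarrow> 'k poly" where
  "F_poly a b = [:1, b, a, 1:]"

definition G_poly :: "'k::field \<Rightarrow> 'k poly" where
  "G_poly b = [:1, 2 * b, b ^ 2, 4:]"

definition E1 :: "('k::field \<Rightarrow> 'f::field) \<Rightarrow> 'k \<Rightarrow> 'k \<Rightarrow> 'f \<Rightarrow> 'f \<Rightarrow> 'f set" where
  "E1 \<iota> a b X Y =
     (let F = eval_at \<iota> (F_poly a b) X;
          U = X ^ 2 / F;
          V = Y * eval_at \<iota> [:- 2, - b, 0, 1:] X / F ^ 2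
      in adjoin \<iota> {U, V})"

text \<open>\<open>r\<close> and \<open>q\<close> stand for chosen square roots of \<open>27 - b\<^sup>3\<close> and \<open>b\<close>. The definition is
  meant for \<open>b \<noteq> 0\<close> only.\<close>

definition E2 ::
  "('k::field \<Rightarrow> 'f::field) \<Rightarrow> 'k \<Rightarrow> 'k \<Rightarrow> 'k \<Rightarrow> 'k \<Rightarrow> 'f \<Rightarrow> 'f \<Rightarrow> 'f set" where
  "E2 \<iota> a b r q X Y =
     (let G = eval_at \<iota> (G_poly b) X in
      if b ^ 3 - 4 * a * b + 9 \<noteq> 0 then
        (let s = - 3 / b;
             t = (3 * a - b ^ 2) / (b ^ 3 - 4 * a * b + 9);
             U = (X - \<iota> s) ^ 2 * (X - \<iota> t) / G;
             V = \<iota> r * Y *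
                 eval_at \<iota> [:1, b, - (b ^ 2 - 4 * a), 4 * a * b - 8 - b ^ 3:] X / G ^ 2
         in adjoin \<iota> {U, V})
      else
        (let U = (\<iota> b * X + 3) ^ 2 / (\<iota> b ^ 2 * G);
             V = \<iota> (8 / b * q) * Y * eval_at \<iota> [:b, b ^ 2, 9, b:] X / G ^ 2
         in adjoin \<iota> {U, V}))"

end

(* Two Weierstrass coordinates x and z of the same field of genus one satisfy an irreducible
   relation Phi(x, z) = 0 of degree at most two in each variable. If both degrees are two, the
   discriminants of Phi with respect to z and to x are constant multiples of the two Weierstrass
   cubics, and the two discriminants of a biquadratic form have the same quartic invariants I and
   J; if both are one, the cubics are related by a Moebius transformation. Degrees one and two
   cannot mix. Hence j is well defined without any theory of places. The two j-invariants are
   then read off from explicit cubics V^2 = c(U), and their difference factors. *)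
theory Submission
  imports Defs
begin

subsection \<open>Evaluation and adjunction\<close>

text \<open>\<open>j_invariant\<close> is a definite description, so exhibiting one Weierstrass
  model settles nothing: any two models of a subfield must be compared, and all that is known of
  their coordinates is that they generate the same field. The degree bound comes from 1 and y
  spanning that field over k(x), and 1 and w over k(z). As for the discriminants, let A z^2 + B z +
  C = 0 over k[x] with z outside k(x). Then B^2 - 4AC = (2Az + B)^2 is a square in k(x, y) but not
  in k(x), hence a square times the cubic f; squarefreeness of f removes denominators, and degree at
  most four makes the square constant. In both cases the quartic degenerates to a multiple c (X^3 +
  AX + B), whose I and J are -3 c^2 A and -27 c^3 B; equality of these fixes the ratio A^3 : B^2,
  which is all that j sees. In place of irreducibility, the proof uses a relation that is primitive
  over k[x] and of minimal degree in z: pseudo-division and Gauss's lemma then show that it divides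
  every other relation.\<close>

lemma map_poly_add_hom:
  assumes "f 0 = 0" and "\<And>x y. f (x + y) = f x + f y"
  shows "map_poly f (p + q) = map_poly f p + map_poly f q"
  using assms by (intro poly_eqI) (simp add: coeff_map_poly)

lemma map_poly_mult_hom:
  fixes f :: "'a::comm_semiring_0 \<Rightarrow> 'b::comm_semiring_0"
  assumes f0: "f 0 = 0" and add: "\<And>x y. f (x + y) = f x + f y"
    and mult: "\<And>x y. f (x * y) = f x * f y"
  shows "map_poly f (p * q) = map_poly f p * map_poly f q"
proof (induction p)
  case (pCons a p)
  have "map_poly f (smult a q) = smult (f a) (map_poly f q)"
    by (simp add: map_poly_smult f0 mult)
  with pCons.IH show ?case
    by (simp add: map_poly_pCons f0 map_poly_add_hom[OF f0 add])
qed simp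

locale embedded_field =
  fixes \<iota> :: "'k::{alg_closed_field, field_char_0} \<Rightarrow> 'f::field"
  assumes emb: "field_embedding \<iota>"
begin

lemma emb_1 [simp]: "\<iota> 1 = 1"
  and emb_add [simp]: "\<iota> (x + y) = \<iota> x + \<iota> y"
  and emb_mult [simp]: "\<iota> (x * y) = \<iota> x * \<iota> y"
  using emb by (auto simp: field_embedding_def)

lemma emb_0 [simp]: "\<iota> 0 = 0"
  using emb_add[of 0 0] by (metis add_cancel_left_left)

lemma emb_uminus [simp]: "\<iota> (- x) = - \<iota> x"
  using emb_add[of x "- x"] by (simp add: eq_neg_iff_add_eq_0 add.commute)

lemma emb_diff [simp]: "\<iota> (x - y) = \<iota> x - \<iota> y"
  using emb_add[of x "- y"] by simp

lemma emb_power [simp]: "\<iota> (x ^ n) = \<iota> x ^ n"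
  by (induction n) auto

lemma emb_of_nat [simp]: "\<iota> (of_nat n) = of_nat n"
  by (induction n) auto

lemma emb_numeral [simp]: "\<iota> (numeral n) = numeral n"
  using emb_of_nat[of "numeral n"] by simp

lemma emb_inverse [simp]: "\<iota> (inverse x) = inverse (\<iota> x)"
proof (cases "x = 0")
  case False
  then have "\<iota> x * \<iota> (inverse x) = 1"
    by (simp flip: emb_mult)
  then show ?thesis
    by (metis inverse_unique)
qed simp

lemma emb_divide [simp]: "\<iota> (x / y) = \<iota> x / \<iota> y"
  by (simp add: divide_inverse)

lemma emb_eq_0_iff [simp]: "\<iota> x = 0 \<longleftrightarrow> x = 0"
proof
  assume "\<iota> x = 0"
  then have "\<iota> (x * inverse x) = 0" by (simp only: emb_mult) simp
  then show "x = 0" by (metis emb_1 right_inverse zero_neq_one)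
qed simp

lemma emb_eq_iff [simp]: "\<iota> x = \<iota> y \<longleftrightarrow> x = y"
  using emb_eq_0_iff[of "x - y"] by simp

abbreviation ev :: "'k poly \<Rightarrow> 'f \<Rightarrow> 'f" where
  "ev \<equiv> eval_at \<iota>"

lemma ev_0 [simp]: "ev 0 x = 0"
  and ev_pCons [simp]: "ev (pCons c p) x = \<iota> c + x * ev p x"
  by (simp_all add: eval_at_def map_poly_pCons)

lemma ev_1 [simp]: "ev 1 x = 1"
  by (simp add: one_pCons)

lemma ev_numeral [simp]: "ev (numeral n) x = numeral n"
  by (simp add: numeral_poly)

lemma ev_add [simp]: "ev (p + q) x = ev p x + ev q x"
  by (simp add: eval_at_def map_poly_add_hom)

lemma ev_mult [simp]: "ev (p * q) x = ev p x * ev q x"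
  by (simp add: eval_at_def map_poly_mult_hom)

lemma ev_smult [simp]: "ev (smult c p) x = \<iota> c * ev p x"
  by (simp add: eval_at_def map_poly_smult)

lemma ev_uminus [simp]: "ev (- p) x = - ev p x"
  using ev_smult[of "-1" p x] by simp

lemma ev_diff [simp]: "ev (p - q) x = ev p x - ev q x"
  using ev_add[of p "- q" x] by simp

lemma ev_power [simp]: "ev (p ^ n) x = ev p x ^ n"
  by (induction n) auto

lemma ev_eq_0_iff: "transcendental_over \<iota> x \<Longrightarrow> ev p x = 0 \<longleftrightarrow> p = 0"
  by (auto simp: transcendental_over_def)

lemma ev_eq_iff: "transcendental_over \<iota> x \<Longrightarrow> ev p x = ev q x \<longleftrightarrow> p = q"
  using ev_eq_0_iff[of x "p - q"] by simp

end

section \<open>Subfields, and the elements of a quadratic extension of k(x)\<close>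

lemma is_subfieldD:
  assumes "is_subfield L"
  shows is_subfield_1: "1 \<in> L" and is_subfield_0: "0 \<in> L"
    and is_subfield_diff: "x \<in> L \<Longrightarrow> y \<in> L \<Longrightarrow> x - y \<in> L"
    and is_subfield_mult: "x \<in> L \<Longrightarrow> y \<in> L \<Longrightarrow> x * y \<in> L"
    and is_subfield_inverse: "x \<in> L \<Longrightarrow> inverse x \<in> L"
    and is_subfield_uminus: "x \<in> L \<Longrightarrow> - x \<in> L"
    and is_subfield_add: "x \<in> L \<Longrightarrow> y \<in> L \<Longrightarrow> x + y \<in> L"
    and is_subfield_divide: "x \<in> L \<Longrightarrow> y \<in> L \<Longrightarrow> x / y \<in> L"
proof -
  show one: "1 \<in> L" using assms by (auto simp: is_subfield_def)
  show diff: "x - y \<in> L" if "x \<in> L" "y \<in> L" for x y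
    using assms that by (auto simp: is_subfield_def)
  show mult: "x * y \<in> L" if "x \<in> L" "y \<in> L" for x y
    using assms that by (auto simp: is_subfield_def)
  show inv: "inverse x \<in> L" if "x \<in> L" for x
    using assms that by (auto simp: is_subfield_def)
  show zero: "0 \<in> L" using diff[OF one one] by simp
  show minus: "- x \<in> L" if "x \<in> L" for x
    using diff[OF zero that] by simp
  show "x + y \<in> L" if "x \<in> L" "y \<in> L" for x y
    using diff[OF that(1) minus[OF that(2)]] by simp
  show "x / y \<in> L" if "x \<in> L" "y \<in> L" for x y
    using mult[OF that(1) inv[OF that(2)]] by (simp add: divide_inverse)
qed

lemma is_subfield_adjoin: "is_subfield (adjoin \<iota> S)"
  unfolding adjoin_def by (rule hull_in) (auto simp: is_subfield_def)

lemma range_subset_adjoin: "\<iota> c \<in> adjoin \<iota> S"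
  unfolding adjoin_def by (simp add: hull_inc)

lemma subset_adjoin: "x \<in> S \<Longrightarrow> x \<in> adjoin \<iota> S"
  unfolding adjoin_def by (simp add: hull_inc)

lemma adjoin_minimal:
  "is_subfield L \<Longrightarrow> range \<iota> \<subseteq> L \<Longrightarrow> S \<subseteq> L \<Longrightarrow> adjoin \<iota> S \<subseteq> L"
  unfolding adjoin_def by (rule hull_minimal) auto

lemmas adjoin_closed = is_subfieldD[OF is_subfield_adjoin] range_subset_adjoin

lemma adjoin_subsetI:
  "S \<subseteq> adjoin \<iota> T \<Longrightarrow> adjoin \<iota> S \<subseteq> adjoin \<iota> T"
  by (rule adjoin_minimal) (auto intro: is_subfield_adjoin range_subset_adjoin)

context embedded_field
begin

text \<open>The elements (P + Q y) / R form a field: the norm \<open>P^2 - Q^2 f\<close> supplies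
  inverses. \<open>nonsquare\<close> asks only that a vanishing norm belong to the zero element,
  which also admits y = 0 with f = 0, that is, k(x) itself.\<close>

lemma adjoin_sqrt_cases:
  assumes x: "transcendental_over \<iota> x" and y: "y\<^sup>2 = ev f x"
    and nonsquare: "\<And>P Q. P\<^sup>2 = Q\<^sup>2 * f \<Longrightarrow> ev P x + ev Q x * y = 0"
    and z: "z \<in> adjoin \<iota> {x, y}"
  obtains P Q R where "R \<noteq> 0" and "ev R x * z = ev P x + ev Q x * y"
proof -
  define L where "L = {z. \<exists>P Q R. R \<noteq> 0 \<and> ev R x * z = ev P x + ev Q x * y}"
  have LI: "z \<in> L" if "R \<noteq> 0" "ev R x * z = ev P x + ev Q x * y" for P Q R z
    using that unfolding L_def by blast
  have one: "1 \<in> L" by (rule LI[of 1 _ 1 0]) auto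
  have closed: "z - w \<in> L \<and> z * w \<in> L" if z: "z \<in> L" and w: "w \<in> L" for z w
  proof -
    obtain P Q R where 1: "R \<noteq> 0" "ev R x * z = ev P x + ev Q x * y"
      using z unfolding L_def by blast
    obtain P' Q' R' where 2: "R' \<noteq> 0" "ev R' x * w = ev P' x + ev Q' x * y"
      using w unfolding L_def by blast
    have "ev (R * R') x * (z - w) = ev R' x * (ev R x * z) - ev R x * (ev R' x * w)"
      by (simp add: algebra_simps)
    also have "\<dots> = ev (P * R' - P' * R) x + ev (Q * R' - Q' * R) x * y"
      unfolding 1 2 by (simp add: algebra_simps)
    finally have "z - w \<in> L" by (rule LI[rotated]) (use 1 2 in auto)
    moreover have "ev (R * R') x * (z * w) = (ev R x * z) * (ev R' x * w)"
      by (simp add: algebra_simps)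
    then have "ev (R * R') x * (z * w) = ev (P * P' + Q * Q' * f) x + ev (P * Q' + P' * Q) x * y"
      unfolding 1 2 by (simp add: algebra_simps power2_eq_square flip: y)
    then have "z * w \<in> L" by (rule LI[rotated]) (use 1 2 in auto)
    ultimately show ?thesis by blast
  qed
  have inverse: "inverse z \<in> L" if z: "z \<in> L" for z
  proof (cases "z = 0")
    case True
    then show ?thesis by (intro LI[of 1 _ 0 0]) auto
  next
    case False
    obtain P Q R where 1: "R \<noteq> 0" "ev R x * z = ev P x + ev Q x * y"
      using z unfolding L_def by blast
    have "P\<^sup>2 - Q\<^sup>2 * f \<noteq> 0"
      using nonsquare[of P Q] 1 False ev_eq_0_iff[OF x, of R] by auto
    moreover have "ev (P\<^sup>2 - Q\<^sup>2 * f) x * inverse z = ev (R * P) x + ev (- R * Q) x * y"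
    proof -
      have "ev (P\<^sup>2 - Q\<^sup>2 * f) x = (ev P x + ev Q x * y) * (ev P x - ev Q x * y)"
        by (simp add: algebra_simps power2_eq_square flip: y)
      also have "\<dots> * inverse z = ev R x * (ev P x - ev Q x * y)"
        using False unfolding 1(2)[symmetric] by (simp add: field_simps)
      finally show ?thesis by (simp add: algebra_simps)
    qed
    ultimately show ?thesis by (rule LI)
  qed
  have "adjoin \<iota> {x, y} \<subseteq> L"
  proof (rule adjoin_minimal)
    show "is_subfield L" unfolding is_subfield_def using one closed inverse by blast
    have "\<iota> c \<in> L" for c by (rule LI[of 1 _ "[:c:]" 0]) auto
    then show "range \<iota> \<subseteq> L" by blast
    have "x \<in> L" by (rule LI[of 1 _ "[:0, 1:]" 0]) auto
    moreover have "y \<in> L" by (rule LI[of 1 _ 0 1]) auto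
    ultimately show "{x, y} \<subseteq> L" by blast
  qed
  with z show thesis using that unfolding L_def by blast
qed

end

subsection \<open>Primitive bivariate relations\<close>

text \<open>The two sides would have degrees of different parity.\<close>

lemma cubic_not_square:
  fixes f P Q :: "'a::idom poly"
  assumes "degree f = 3" and eq: "P\<^sup>2 = Q\<^sup>2 * f"
  shows "P = 0" and "Q = 0"
proof -
  have f: "f \<noteq> 0" using assms(1) by auto
  show Q: "Q = 0"
  proof (rule ccontr)
    assume Q: "Q \<noteq> 0"
    then have "2 * degree P = 2 * degree Q + 3"
      using arg_cong[OF eq, of degree] f assms(1)
      by (simp add: degree_mult_eq degree_power_eq power2_eq_square) (cases "P = 0"; simp add: degree_mult_eq)
    then show False by presburger
  qed
  show "P = 0" using eq Q by simp
qed

definition no_double_root :: "'a::comm_ring_1 poly \<Rightarrow> bool" where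
  "no_double_root f \<longleftrightarrow> (\<forall>c. \<not> [:- c, 1:]\<^sup>2 dvd f)"

text \<open>A linear factor l of \<open>D\<close> gives l^2 dividing \<open>S^2 f\<close>. Since l^2
  does not divide \<open>f\<close>, l divides \<open>S\<close>, so l^2 cancels on both sides and the
  degree of \<open>D\<close> drops.\<close>

lemma square_denominator_cancel:
  fixes f :: "'a::alg_closed_field poly"
  assumes f: "no_double_root f"
  shows "D \<noteq> 0 \<Longrightarrow> D\<^sup>2 * \<delta> = S\<^sup>2 * f \<Longrightarrow> \<exists>h. \<delta> = h\<^sup>2 * f"
proof (induction "degree D" arbitrary: D S rule: less_induct)
  case less
  show ?case
  proof (cases "degree D = 0")
    case True
    then obtain d where "D = [:d:]" by (auto elim: degree_eq_zeroE)
    with less.prems have "\<delta> = (smult (inverse d) S)\<^sup>2 * f"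
      by (simp add: power2_eq_square smult_eq_iff)
        (metis (no_types, lifting) divide_inverse_commute field_class.field_inverse
          mult_smult_left smult_1_left smult_smult)
    then show ?thesis by blast
  next
    case False
    then obtain c where c: "poly D c = 0" using alg_closed_imp_poly_has_root[of D] by auto
    let ?l = "[:- c, 1:]"
    obtain D' where D': "D = ?l * D'" using c by (auto simp: poly_eq_0_iff_dvd)
    have "poly S c = 0"
    proof (rule ccontr)
      assume S: "poly S c \<noteq> 0"
      have l: "?l * (?l * (D'\<^sup>2 * \<delta>)) = S\<^sup>2 * f"
        unfolding less.prems(2)[symmetric] D' by (simp only: power2_eq_square ac_simps)
      have "poly (S\<^sup>2 * f) c = 0" unfolding l[symmetric] poly_mult by simp
      then have "poly f c = 0" using S by simp
      then obtain g where g: "f = ?l * g" by (auto simp: poly_eq_0_iff_dvd)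
      have "?l * (?l * (D'\<^sup>2 * \<delta>)) = ?l * (S\<^sup>2 * g)"
        unfolding l g by (simp only: ac_simps)
      then have l': "?l * (D'\<^sup>2 * \<delta>) = S\<^sup>2 * g"
        by (subst (asm) mult_left_cancel) auto
      have "poly (S\<^sup>2 * g) c = 0" unfolding l'[symmetric] poly_mult by simp
      then have "poly g c = 0" using S by simp
      then obtain g' where g': "g = ?l * g'" by (auto simp: poly_eq_0_iff_dvd)
      have "f = ?l\<^sup>2 * g'" unfolding g g' by (simp only: power2_eq_square mult.assoc)
      then show False using f unfolding no_double_root_def by (metis dvd_triv_left)
    qed
    then obtain S' where S': "S = ?l * S'" by (auto simp: poly_eq_0_iff_dvd)
    have "?l\<^sup>2 * (D'\<^sup>2 * \<delta>) = ?l\<^sup>2 * (S'\<^sup>2 * f)"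
      using less.prems(2) unfolding D' S' by (simp only: power_mult_distrib mult.assoc)
    then have "D'\<^sup>2 * \<delta> = S'\<^sup>2 * f"
      by (subst (asm) mult_left_cancel) auto
    moreover have "D' \<noteq> 0" using less.prems D' by auto
    moreover then have "degree D' < degree D" unfolding D' by (simp add: degree_mult_eq del: mult_pCons_left)
    ultimately show ?thesis using less.hyps by blast
  qed
qed

text \<open>Four is the degree bound for the discriminant of a biquadratic form, and 2 deg h + 3
  \<le> 4 leaves only constants.\<close>

lemma square_times_cubic_degree_le_4:
  fixes f h :: "'a::idom poly"
  assumes "degree (h\<^sup>2 * f) \<le> 4" and "degree f = 3"
  obtains c where "h = [:c:]"
proof (cases "h = 0")
  case False
  have "f \<noteq> 0" using assms(2) by auto
  with False assms have "2 * degree h + 3 \<le> 4"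
    by (simp add: degree_mult_eq power2_eq_square)
  then have "degree h = 0" by simp
  then show ?thesis using that by (auto elim: degree_eq_zeroE)
qed (use that[of 0] in simp)

text \<open>At a double root the cubic and its derivative both vanish; eliminating the root from the
  two equations gives discriminant zero.\<close>

lemma weierstrass_no_double_root:
  fixes A B :: "'a::idom"
  assumes "4 * A ^ 3 + 27 * B ^ 2 \<noteq> 0"
  shows "no_double_root [:B, A, 0, 1:]"
  unfolding no_double_root_def
proof (intro allI notI)
  fix c
  assume "[:- c, 1:]\<^sup>2 dvd [:B, A, 0, 1:]"
  then obtain g where g: "[:B, A, 0, 1:] = [:- c, 1:]\<^sup>2 * g" by (auto simp: dvd_def)
  have 1: "c ^ 3 + A * c + B = 0"
    using arg_cong[OF g, of "\<lambda>p. poly p c"] by (simp add: algebra_simps power3_eq_cube)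
  have "poly (pderiv ([:- c, 1:]\<^sup>2 * g)) c = 0"
    by (simp only: power2_eq_square mult.assoc pderiv_mult poly_add poly_mult) simp
  then have 2: "3 * c\<^sup>2 + A = 0"
    unfolding g[symmetric] by (simp add: pderiv_pCons power2_eq_square algebra_simps)
  have "4 * A ^ 3 + 27 * B ^ 2 = 0" using 1 2 by algebra
  with assms show False by simp
qed

text \<open>Over an algebraically closed field a nonunit content has a linear factor, so excluding
  constants of the form \<open>[:- c, 1:]\<close> as divisors amounts to primitivity.\<close>

definition primitive :: "'a::comm_ring_1 poly poly \<Rightarrow> bool" where
  "primitive \<Phi> \<longleftrightarrow> (\<forall>c. \<not> [:[:- c, 1:]:] dvd \<Phi>)"

lemma primitive_part:
  fixes \<Phi> :: "'a::field poly poly"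
  shows "\<Phi> \<noteq> 0 \<Longrightarrow> \<exists>D \<Psi>. D \<noteq> 0 \<and> \<Phi> = smult D \<Psi> \<and> primitive \<Psi>"
proof (induction "degree (lead_coeff \<Phi>)" arbitrary: \<Phi> rule: less_induct)
  case less
  show ?case
  proof (cases "primitive \<Phi>")
    case True
    then show ?thesis by (intro exI[of _ 1] exI[of _ \<Phi>]) auto
  next
    case False
    then obtain c \<Psi> where \<Psi>: "\<Phi> = smult [:- c, 1:] \<Psi>"
      by (auto simp: primitive_def dvd_def)
    with less.prems have "\<Psi> \<noteq> 0" by auto
    moreover then have "degree (lead_coeff \<Psi>) < degree (lead_coeff \<Phi>)"
      unfolding \<Psi> by (simp add: degree_mult_eq del: mult_pCons_left)
    ultimately obtain D \<Psi>' where "D \<noteq> 0" "\<Psi> = smult D \<Psi>'" "primitive \<Psi>'"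
      using less.hyps by blast
    then show ?thesis using \<Psi>
      by (intro exI[of _ "[:- c, 1:] * D"] exI[of _ \<Psi>']) (auto simp del: mult_pCons_left)
  qed
qed

text \<open>Gauss's lemma, one root of \<open>d\<close> at a time: a linear polynomial in the inner
  variable stays prime in the bivariate ring, and as it does not divide \<open>\<Phi>\<close> it
  divides \<open>Q\<close>.\<close>

lemma primitive_dvd_cancel:
  fixes \<Phi> \<Psi> :: "'a::alg_closed_field poly poly"
  assumes \<Phi>: "primitive \<Phi>"
  shows "d \<noteq> 0 \<Longrightarrow> smult d \<Psi> = \<Phi> * Q \<Longrightarrow> \<Phi> dvd \<Psi>"
proof (induction "degree d" arbitrary: d Q rule: less_induct)
  case less
  show ?case
  proof (cases "degree d = 0")
    case True
    then obtain e where d: "d = [:e:]" by (auto elim: degree_eq_zeroE)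
    with less.prems have e: "e \<noteq> 0" by auto
    have "\<Psi> = smult ([:inverse e:] * d) \<Psi>" using e d by (simp flip: one_pCons)
    also have "\<dots> = \<Phi> * smult [:inverse e:] Q"
      unfolding smult_smult[symmetric] less.prems(2) by simp
    finally show ?thesis by (rule dvdI)
  next
    case False
    then obtain c where c: "poly d c = 0" using alg_closed_imp_poly_has_root[of d] by auto
    let ?l = "[:- c, 1:]"
    obtain d' where d': "d = ?l * d'" using c by (auto simp: poly_eq_0_iff_dvd)
    have "prime_elem ?l"
      by (rule prime_elemI)
        (auto simp: poly_eq_0_iff_dvd[symmetric] poly_mult is_unit_iff_degree)
    then have prime: "prime_elem [:?l:]" by (rule lift_prime_elem_poly)
    have "smult d \<Psi> = [:?l:] * smult d' \<Psi>"
      unfolding d' by (simp del: mult_pCons_left add: mult.commute)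
    then have "[:?l:] dvd \<Phi> * Q" unfolding less.prems(2)[symmetric] by (metis dvd_triv_left)
    with prime \<Phi> have "[:?l:] dvd Q"
      by (auto simp: prime_elem_dvd_mult_iff primitive_def)
    then obtain Q' where Q': "Q = smult ?l Q'" by (auto simp: dvd_def)
    have "smult ?l (smult d' \<Psi>) = smult ?l (\<Phi> * Q')"
      using less.prems(2) unfolding d' Q' smult_smult by (simp del: mult_pCons_left)
    then have "smult ?l (smult d' \<Psi> - \<Phi> * Q') = 0" by (simp add: smult_diff_right)
    then have "smult d' \<Psi> = \<Phi> * Q'" by simp
    moreover have "d' \<noteq> 0" using less.prems d' by auto
    moreover then have "degree d' < degree d" unfolding d' by (simp add: degree_mult_eq del: mult_pCons_left)
    ultimately show ?thesis using less.hyps by blast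
  qed
qed

text \<open>Specialising the outer variable to a generic constant turns the divisibility into one of
  polynomials in the inner variable.\<close>

lemma dvd_coeff_degree_le:
  fixes \<Phi> \<Psi> :: "'a::{idom, ring_char_0} poly poly"
  assumes dvd: "\<Phi> dvd \<Psi>" and "\<Psi> \<noteq> 0" and \<Psi>: "\<And>j. degree (coeff \<Psi> j) \<le> m"
  shows "degree (coeff \<Phi> j) \<le> m"
proof (rule ccontr)
  define n where "n = degree (coeff \<Phi> j)"
  \<comment> \<open>\<open>\<phi>\<close> collects the terms of inner degree \<open>n\<close> as a
    polynomial in the outer variable. A value t outside its finitely many roots forces inner degree
    at least \<open>n\<close> on \<open>\<Phi>\<close> specialised at t.\<close>
  define \<phi> where "\<phi> = map_poly (\<lambda>p. coeff p n) \<Phi>"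
  assume "\<not> degree (coeff \<Phi> j) \<le> m"
  then have n: "n > m" unfolding n_def by simp
  then have "coeff \<phi> j \<noteq> 0"
    unfolding \<phi>_def n_def by (auto simp: coeff_map_poly)
  then have "\<phi> \<noteq> 0" by auto
  then have 1: "finite {t. poly \<phi> t = 0}" by (rule poly_roots_finite)
  have 2: "finite ((\<lambda>t. [:t:]) -` {s. poly \<Psi> s = 0})"
    using poly_roots_finite[OF \<open>\<Psi> \<noteq> 0\<close>] by (rule finite_vimageI) (auto simp: inj_on_def)
  obtain t where "t \<notin> {t. poly \<phi> t = 0} \<union> (\<lambda>t. [:t:]) -` {s. poly \<Psi> s = 0}"
    using ex_new_if_finite[OF infinite_UNIV_char_0 finite_UnI[OF 1 2]] by blast
  then have t: "poly \<phi> t \<noteq> 0" "poly \<Psi> [:t:] \<noteq> 0" by auto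
  have coeff: "coeff (poly P [:t:]) i = poly (map_poly (\<lambda>p. coeff p i) P) t" for P i
    by (induction P) (auto simp: map_poly_pCons mult.commute)
  obtain Q where Q: "\<Psi> = \<Phi> * Q" using dvd by (auto simp: dvd_def)
  have "n \<le> degree (poly \<Phi> [:t:])"
    by (rule le_degree) (use t in \<open>simp add: coeff \<phi>_def\<close>)
  also have "\<dots> \<le> degree (poly \<Psi> [:t:])"
    using t(2) unfolding Q by (auto simp: degree_mult_eq)
  also have "\<dots> \<le> m"
  proof (rule degree_le, intro allI impI)
    fix i assume "m < i"
    then have "coeff (coeff \<Psi> j) i = 0" for j
      using \<Psi>[of j] by (simp add: coeff_eq_0)
    then have "map_poly (\<lambda>p. coeff p i) \<Psi> = 0"
      by (intro poly_eqI) (simp add: coeff_map_poly)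
    then show "coeff (poly \<Psi> [:t:]) i = 0" by (simp add: coeff)
  qed
  finally show False using n by simp
qed

section \<open>Polynomial relations between two elements\<close>

context embedded_field
begin

definition bev :: "'f \<Rightarrow> 'f \<Rightarrow> 'k poly poly \<Rightarrow> 'f" where
  "bev x t \<Phi> = poly (map_poly (\<lambda>p. ev p x) \<Phi>) t"

lemma bev_0 [simp]: "bev x t 0 = 0"
  and bev_pCons [simp]: "bev x t (pCons p \<Phi>) = ev p x + t * bev x t \<Phi>"
  by (simp_all add: bev_def map_poly_pCons)

lemma bev_add [simp]: "bev x t (\<Phi> + \<Psi>) = bev x t \<Phi> + bev x t \<Psi>"
  by (simp add: bev_def map_poly_add_hom)

lemma bev_mult [simp]: "bev x t (\<Phi> * \<Psi>) = bev x t \<Phi> * bev x t \<Psi>"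
  by (simp add: bev_def map_poly_mult_hom)

lemma bev_smult [simp]: "bev x t (smult p \<Phi>) = ev p x * bev x t \<Phi>"
  by (simp add: bev_def map_poly_smult)

text \<open>The remainder of pseudo-division by \<open>\<Phi>\<close> vanishes at the same point and
  has smaller degree, so it is zero; primitivity removes the factor that pseudo-division
  introduces.\<close>

lemma minimal_relation_dvd:
  assumes "primitive \<Phi>" and "\<Phi> \<noteq> 0" and "bev x t \<Phi> = 0" and "bev x t \<Psi> = 0"
    and min: "\<And>R. R \<noteq> 0 \<Longrightarrow> degree R < degree \<Phi> \<Longrightarrow> bev x t R \<noteq> 0"
  shows "\<Phi> dvd \<Psi>"
proof -
  obtain Q R where QR: "pseudo_divmod \<Psi> \<Phi> = (Q, R)" by fastforce
  note pd = pseudo_divmod[OF \<open>\<Phi> \<noteq> 0\<close> QR]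
  define d where "d = lead_coeff \<Phi> ^ (Suc (degree \<Psi>) - degree \<Phi>)"
  have eq: "smult d \<Psi> = \<Phi> * Q + R" unfolding d_def by (rule pd)
  then have "bev x t (smult d \<Psi>) = bev x t (\<Phi> * Q + R)" by simp
  then have "bev x t R = 0" by (simp add: assms)
  with min pd(2) have "R = 0" by blast
  with eq have "smult d \<Psi> = \<Phi> * Q" by simp
  then show ?thesis using assms by (intro primitive_dvd_cancel[of \<Phi> d]) (auto simp: d_def)
qed

end

lemma poly_eq_pCons2:
  assumes "degree p \<le> 2"
  shows "p = [:coeff p 0, coeff p 1, coeff p 2:]"
  using assms by (intro poly_eqI) (auto simp: coeff_pCons coeff_eq_0 numeral_2_eq_2 split: nat.splits)

section \<open>Relations in the function field of a squarefree cubic\<close>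

context embedded_field
begin

definition cubic_sqrt :: "'k poly \<Rightarrow> 'f \<Rightarrow> 'f \<Rightarrow> bool" where
  "cubic_sqrt f x y \<longleftrightarrow>
     transcendental_over \<iota> x \<and> y\<^sup>2 = ev f x \<and> degree f = 3 \<and> no_double_root f"

lemma sqrt_independent:
  assumes "cubic_sqrt f x y" and "ev P x + ev Q x * y = 0"
  shows "P = 0" and "Q = 0"
proof -
  have x: "transcendental_over \<iota> x" and y: "y\<^sup>2 = ev f x" and f: "degree f = 3"
    using assms(1) by (auto simp: cubic_sqrt_def)
  have "ev P x = - (ev Q x * y)" using assms(2) by (simp add: eq_neg_iff_add_eq_0)
  then have "ev (P\<^sup>2) x = ev (Q\<^sup>2 * f) x"
    by (simp add: power_mult_distrib y)
  then have "P\<^sup>2 = Q\<^sup>2 * f" using ev_eq_iff[OF x] by blast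
  then show "P = 0" "Q = 0" using cubic_not_square[OF f] by blast+
qed

lemma adjoin_cubic_sqrt_cases:
  assumes "cubic_sqrt f x y" and "z \<in> adjoin \<iota> {x, y}"
  obtains P Q R where "R \<noteq> 0" and "ev R x * z = ev P x + ev Q x * y"
proof (rule adjoin_sqrt_cases[of x y f z])
  show "ev P x + ev Q x * y = 0" if "P\<^sup>2 = Q\<^sup>2 * f" for P Q
    using assms(1) cubic_not_square[of f P Q] that by (simp add: cubic_sqrt_def)
qed (use assms that in \<open>auto simp: cubic_sqrt_def\<close>)

lemma linear_relation_trivial:
  assumes xy: "cubic_sqrt f x y" and R: "R \<noteq> 0" "ev R x * z = ev P x + ev Q x * y" and "Q \<noteq> 0"
    and rel: "ev B x * z + ev C x = 0"
  shows "B = 0" and "C = 0"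
proof -
  have "ev (B * P + C * R) x + ev (B * Q) x * y = ev R x * (ev B x * z + ev C x)"
    using R(2) by (simp add: algebra_simps) (metis (no_types, lifting) distrib_left mult.assoc mult.left_commute)
  also have "\<dots> = 0" using rel by simp
  finally have "B * Q = 0" by (rule sqrt_independent[OF xy])
  then show "B = 0" using \<open>Q \<noteq> 0\<close> by simp
  with rel have "ev C x = 0" by simp
  then show "C = 0" using xy ev_eq_0_iff by (auto simp: cubic_sqrt_def)
qed

text \<open>Write R (2Az + B) = M + N y with M = 2AP + BR and N = 2AQ. Its square lies in k[x], so
  the y-part 2MN vanishes; N is nonzero, hence M = 0 and R^2 times the discriminant is N^2
  f.\<close>

lemma quadratic_relation_discriminant:
  assumes xy: "cubic_sqrt f x y" and R: "R \<noteq> 0" "ev R x * z = ev P x + ev Q x * y" and "Q \<noteq> 0"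
    and rel: "ev A x * z\<^sup>2 + ev B x * z + ev C x = 0" and nz: "\<not> (A = 0 \<and> B = 0 \<and> C = 0)"
  obtains h where "A \<noteq> 0" and "h \<noteq> 0" and "B\<^sup>2 - 4 * A * C = h\<^sup>2 * f"
proof -
  have x: "transcendental_over \<iota> x" and y: "y\<^sup>2 = ev f x" and f: "no_double_root f"
    using xy by (auto simp: cubic_sqrt_def)
  have A: "A \<noteq> 0" using linear_relation_trivial[OF xy R \<open>Q \<noteq> 0\<close>, of B C] rel nz by auto
  have "(ev R x)\<^sup>2 * ev (B\<^sup>2 - 4 * A * C) x = (ev R x * (2 * ev A x * z + ev B x))\<^sup>2"
    unfolding ev_diff ev_mult ev_power ev_numeral using rel by algebra
  also have "ev R x * (2 * ev A x * z + ev B x) = 2 * ev A x * (ev R x * z) + ev B x * ev R x"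
    by (simp add: algebra_simps)
  also have "\<dots> = ev (2 * A * P + B * R) x + ev (2 * A * Q) x * y"
    unfolding R(2) by (simp add: algebra_simps)
  finally have eq: "ev (R\<^sup>2 * (B\<^sup>2 - 4 * A * C)) x
      = (ev (2 * A * P + B * R) x + ev (2 * A * Q) x * y)\<^sup>2" by simp
  have "ev ((2 * A * P + B * R)\<^sup>2 + (2 * A * Q)\<^sup>2 * f - R\<^sup>2 * (B\<^sup>2 - 4 * A * C)) x
      + ev (2 * (2 * A * P + B * R) * (2 * A * Q)) x * y = 0"
    using eq unfolding ev_diff ev_add ev_mult ev_power y[symmetric] ev_numeral by algebra
  note sqrt_independent[OF xy this]
  moreover from this(2) A \<open>Q \<noteq> 0\<close> have "2 * A * P + B * R = 0"
    by (metis mult_eq_0_iff zero_neq_numeral)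
  ultimately have eq: "R\<^sup>2 * (B\<^sup>2 - 4 * A * C) = (2 * A * Q)\<^sup>2 * f" by simp
  from square_denominator_cancel[OF f \<open>R \<noteq> 0\<close> this]
  obtain h where h: "B\<^sup>2 - 4 * A * C = h\<^sup>2 * f" by blast
  have "f \<noteq> 0" using xy by (auto simp: cubic_sqrt_def)
  then have "(2 * A * Q)\<^sup>2 * f \<noteq> 0" using A \<open>Q \<noteq> 0\<close> by auto
  then have "h \<noteq> 0" unfolding eq[symmetric] h by auto
  then show thesis using that A h by blast
qed

text \<open>The primitive part of the minimal polynomial of z over k(x). A linear relation is stored
  with A = 0, so that both degrees share one triple of coefficients.\<close>

lemma primitive_relation:
  assumes xy: "cubic_sqrt f x y" and R: "R \<noteq> 0" "ev R x * z = ev P x + ev Q x * y"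
  obtains A B C where "primitive [:C, B, A:]" and "ev A x * z\<^sup>2 + ev B x * z + ev C x = 0"
    and "\<And>S. S \<noteq> 0 \<Longrightarrow> degree S < degree [:C, B, A:] \<Longrightarrow> bev x z S \<noteq> 0"
    and "if Q = 0 then A = 0 \<and> B \<noteq> 0 else A \<noteq> 0"
proof -
  have x: "transcendental_over \<iota> x" and y: "y\<^sup>2 = ev f x"
    using xy by (auto simp: cubic_sqrt_def)
  \<comment> \<open>For nonzero \<open>Q\<close> this is the expansion of (R T - P)^2 - Q^2 f, that
    is, the norm of R T - P - Q y.\<close>
  define \<Phi> where "\<Phi> = (if Q = 0 then [:- P, R:] else [:P\<^sup>2 - Q\<^sup>2 * f, - 2 * R * P, R\<^sup>2:])"
  have deg: "degree \<Phi> = (if Q = 0 then 1 else 2)"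
    using R unfolding \<Phi>_def by simp
  have "bev x z \<Phi> = 0"
  proof (cases "Q = 0")
    case True
    then show ?thesis using R(2) by (simp add: \<Phi>_def mult.commute)
  next
    case False
    have "(ev R x * z - ev P x)\<^sup>2 = (ev Q x)\<^sup>2 * ev f x"
      unfolding R(2) y[symmetric] by (simp add: power_mult_distrib)
    then have "(ev P x)\<^sup>2 - (ev Q x)\<^sup>2 * ev f x + z * (- 2 * ev R x * ev P x + z * (ev R x)\<^sup>2) = 0"
      by algebra
    then show ?thesis using False by (simp add: \<Phi>_def)
  qed
  have "\<Phi> \<noteq> 0" using deg by (auto split: if_splits)
  then obtain D \<Psi> where D: "D \<noteq> 0" "\<Phi> = smult D \<Psi>" "primitive \<Psi>"
    using primitive_part by blast
  have deg': "degree \<Psi> = (if Q = 0 then 1 else 2)" using deg D by simp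
  define A B C where ABC: "A = coeff \<Psi> 2" "B = coeff \<Psi> 1" "C = coeff \<Psi> 0"
  have \<Psi>: "\<Psi> = [:C, B, A:]"
    unfolding ABC by (rule poly_eq_pCons2) (simp add: deg')
  have "bev x z \<Psi> = 0"
    using \<open>bev x z \<Phi> = 0\<close> D ev_eq_0_iff[OF x] by simp
  then have rel: "ev A x * z\<^sup>2 + ev B x * z + ev C x = 0"
    unfolding \<Psi> by (simp add: power2_eq_square algebra_simps)
  have min: "bev x z S \<noteq> 0" if S: "S \<noteq> 0" "degree S < degree [:C, B, A:]" for S
  proof
    assume 0: "bev x z S = 0"
    have dS: "degree S < (if Q = 0 then 1 else 2)" using S deg' unfolding \<Psi> by simp
    define b c where bc: "b = coeff S 1" "c = coeff S 0"
    have S': "S = [:c, b:]"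
      using poly_eq_pCons2[of S] dS by (simp add: bc coeff_eq_0 split: if_splits)
    show False
    proof (cases "Q = 0")
      case True
      with dS have "b = 0" by (simp add: bc coeff_eq_0)
      with S' 0 S ev_eq_0_iff[OF x] show False by simp
    next
      case False
      have "ev b x * z + ev c x = 0" using 0 unfolding S' by (simp add: algebra_simps)
      from linear_relation_trivial[OF xy R False this] S S' show False by simp
    qed
  qed
  have "if Q = 0 then A = 0 \<and> B \<noteq> 0 else A \<noteq> 0"
    using deg' unfolding \<Psi> by (auto split: if_splits)
  then show thesis using that D \<Psi> rel min by blast
qed

lemma bev_lift: "bev x t (map_poly (\<lambda>c. [:c:]) p) = ev p t"
  by (induction p) (simp_all add: map_poly_pCons)

text \<open>The relation for x over k[z], reread as a polynomial in z with coefficients in k[x], has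
  x-degree at most \<open>m\<close>. It is a multiple of the primitive relation, which inherits the
  bound.\<close>

lemma primitive_relation_degree_le:
  assumes z: "transcendental_over \<iota> z"
    and \<Phi>: "primitive [:C, B, A:]" and rel: "ev A x * z\<^sup>2 + ev B x * z + ev C x = 0"
    and min: "\<And>S. S \<noteq> 0 \<Longrightarrow> degree S < degree [:C, B, A:] \<Longrightarrow> bev x z S \<noteq> 0"
    and nz: "A \<noteq> 0 \<or> B \<noteq> 0"
    and rel': "ev A' z * x\<^sup>2 + ev B' z * x + ev C' z = 0" and nz': "A' \<noteq> 0 \<or> B' \<noteq> 0"
  defines "m \<equiv> (if A' = 0 then 1 else 2)"
  shows "degree A \<le> m" and "degree B \<le> m" and "degree C \<le> m"
proof -
  let ?lift = "map_poly (\<lambda>c. [:c:]) :: 'k poly \<Rightarrow> 'k poly poly"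
  \<comment> \<open>Exchange of the two variables: \<open>?lift\<close> turns z into the outer
    variable, and powers of x become the inner scalars.\<close>
  define \<Psi> where "\<Psi> = ?lift C' + smult [:0, 1:] (?lift B') + smult [:0, 0, 1:] (?lift A')"
  have coeff: "coeff \<Psi> j = [:coeff C' j, coeff B' j, coeff A' j:]" for j
    by (simp add: \<Psi>_def coeff_map_poly)
  have "\<Psi> \<noteq> 0"
  proof
    assume "\<Psi> = 0"
    then have "[:coeff C' j, coeff B' j, coeff A' j:] = 0" for j
      using coeff[of j] by simp
    then have "A' = 0" "B' = 0" by (auto intro!: poly_eqI)
    with nz' show False by simp
  qed
  have "bev x z [:C, B, A:] = 0"
    using rel by (simp add: power2_eq_square algebra_simps)
  moreover have "bev x z \<Psi> = 0"
    using rel' by (simp add: \<Psi>_def bev_lift power2_eq_square algebra_simps)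
  moreover have "[:C, B, A:] \<noteq> 0" using nz by auto
  ultimately have dvd: "[:C, B, A:] dvd \<Psi>"
    using \<Phi> min by (intro minimal_relation_dvd) auto
  have "degree (coeff \<Psi> j) \<le> m" for j
    unfolding coeff m_def by (auto intro!: degree_pCons_le[THEN order_trans])
  note le = dvd_coeff_degree_le[OF dvd \<open>\<Psi> \<noteq> 0\<close> this]
  show "degree A \<le> m" "degree B \<le> m" "degree C \<le> m"
    using le[of 2] le[of 1] le[of 0] by (simp_all add: numeral_2_eq_2)
qed

end

subsection \<open>Uniqueness of the j-invariant\<close>

text \<open>The invariants \<open>I\<close> and \<open>J\<close> of the binary quartics with coefficients \<open>d\<^sub>i\<close> and \<open>e\<^sub>i\<close>, which are
  the discriminants of \<open>\<Sum> (a\<^sub>i T\<^sup>2 + b\<^sub>i T + c\<^sub>i) X\<^sup>i\<close> with respect to \<open>T\<close> and to \<open>X\<close>.\<close>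

lemma biquadratic_discriminant_invariants:
  fixes a0 a1 a2 b0 b1 b2 c0 c1 c2 :: "'a::idom"
  defines "d4 \<equiv> b2\<^sup>2 - 4 * a2 * c2" and "d3 \<equiv> 2 * b2 * b1 - 4 * (a2 * c1 + a1 * c2)"
    and "d2 \<equiv> b1\<^sup>2 + 2 * b2 * b0 - 4 * (a2 * c0 + a1 * c1 + a0 * c2)"
    and "d1 \<equiv> 2 * b0 * b1 - 4 * (a0 * c1 + a1 * c0)" and "d0 \<equiv> b0\<^sup>2 - 4 * a0 * c0"
  defines "e4 \<equiv> a1\<^sup>2 - 4 * a2 * a0" and "e3 \<equiv> 2 * a1 * b1 - 4 * (a2 * b0 + b2 * a0)"
    and "e2 \<equiv> b1\<^sup>2 + 2 * c1 * a1 - 4 * (c2 * a0 + b2 * b0 + a2 * c0)"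
    and "e1 \<equiv> 2 * c1 * b1 - 4 * (c2 * b0 + b2 * c0)" and "e0 \<equiv> c1\<^sup>2 - 4 * c2 * c0"
  shows "12 * d4 * d0 - 3 * d3 * d1 + d2\<^sup>2 = 12 * e4 * e0 - 3 * e3 * e1 + e2\<^sup>2"
    and "72 * d4 * d2 * d0 + 9 * d3 * d2 * d1 - 27 * d4 * d1\<^sup>2 - 27 * d0 * d3\<^sup>2 - 2 * d2 ^ 3
      = 72 * e4 * e2 * e0 + 9 * e3 * e2 * e1 - 27 * e4 * e1\<^sup>2 - 27 * e0 * e3\<^sup>2 - 2 * e2 ^ 3"
  unfolding assms by algebra+

lemma biquadratic_coeff:
  fixes a0 a1 a2 b0 b1 b2 c0 c1 c2 :: "'a::idom"
  assumes "[:b0, b1, b2:]\<^sup>2 - 4 * [:a0, a1, a2:] * [:c0, c1, c2:] = smult k [:B, A, 0, 1:]"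
  shows "b2\<^sup>2 - 4 * a2 * c2 = 0" and "2 * b2 * b1 - 4 * (a2 * c1 + a1 * c2) = k"
    and "b1\<^sup>2 + 2 * b2 * b0 - 4 * (a2 * c0 + a1 * c1 + a0 * c2) = 0"
    and "2 * b0 * b1 - 4 * (a0 * c1 + a1 * c0) = k * A" and "b0\<^sup>2 - 4 * a0 * c0 = k * B"
  using arg_cong[OF assms, of "\<lambda>p. coeff p 4"] arg_cong[OF assms, of "\<lambda>p. coeff p 3"]
    arg_cong[OF assms, of "\<lambda>p. coeff p 2"] arg_cong[OF assms, of "\<lambda>p. coeff p 1"]
    arg_cong[OF assms, of "\<lambda>p. coeff p 0"]
  by (simp_all add: numeral_poly power2_eq_square eval_nat_numeral algebra_simps)

text \<open>Cubing the first relation and squaring the second makes both scale by sixth powers, so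
  \<open>A^3 B'^2 = A'^3 B^2\<close>. The product form also covers vanishing coefficients.\<close>

lemma j_eq_of_scaled:
  fixes A B A' B' :: "'a::field"
  assumes "\<alpha> \<noteq> 0" and "\<beta> \<noteq> 0" and 1: "\<alpha>\<^sup>2 * A = \<beta>\<^sup>2 * A'" and 2: "\<alpha> ^ 3 * B = \<beta> ^ 3 * B'"
    and "4 * A ^ 3 + 27 * B\<^sup>2 \<noteq> 0" and "4 * A' ^ 3 + 27 * B'\<^sup>2 \<noteq> 0"
  shows "1728 * (4 * A ^ 3) / (4 * A ^ 3 + 27 * B\<^sup>2) = 1728 * (4 * A' ^ 3) / (4 * A' ^ 3 + 27 * B'\<^sup>2)"
proof -
  have 3: "\<alpha> ^ 6 * A ^ 3 = \<beta> ^ 6 * A' ^ 3" using 1 by algebra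
  have 4: "\<alpha> ^ 6 * B\<^sup>2 = \<beta> ^ 6 * B'\<^sup>2" using 2 by algebra
  have "\<alpha> ^ 6 * \<beta> ^ 6 * (A ^ 3 * B'\<^sup>2) = \<alpha> ^ 6 * \<beta> ^ 6 * (A' ^ 3 * B\<^sup>2)"
    using 3 4 by algebra
  then have "A ^ 3 * B'\<^sup>2 = A' ^ 3 * B\<^sup>2" using assms by simp
  then have "1728 * (4 * A ^ 3) * (4 * A' ^ 3 + 27 * B'\<^sup>2) = 1728 * (4 * A' ^ 3) * (4 * A ^ 3 + 27 * B\<^sup>2)"
    by algebra
  then show ?thesis using assms by (simp add: frac_eq_eq)
qed

context embedded_field
begin

lemma weierstrass_cubic_sqrt:
  "4 * A ^ 3 + 27 * B\<^sup>2 \<noteq> 0 \<Longrightarrow> transcendental_over \<iota> x \<Longrightarrow> y\<^sup>2 = ev [:B, A, 0, 1:] x \<Longrightarrow>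
    cubic_sqrt [:B, A, 0, 1:] x y"
  by (simp add: cubic_sqrt_def weierstrass_no_double_root del: ev_pCons)

text \<open>This excludes degree one in z together with degree two in x: read as a quadratic in x,
  such a relation has coefficients linear in z and a discriminant of degree at most 2, yet the
  discriminant is a nonzero square times a cubic.\<close>

lemma rational_in_both_directions:
  assumes xy: "cubic_sqrt f x y" and zw: "cubic_sqrt g z w"
    and R: "R \<noteq> 0" "ev R x * z = ev P x"
    and R': "R' \<noteq> 0" "ev R' z * x = ev P' z + ev Q' z * w"
  shows "Q' = 0"
proof (rule ccontr)
  assume Q': "Q' \<noteq> 0"
  have "ev R x * z = ev P x + ev 0 x * y" using R by simp
  from primitive_relation[OF xy R(1) this] obtain B C where \<Phi>: "primitive [:C, B, 0:]"
    and rel: "ev 0 x * z\<^sup>2 + ev B x * z + ev C x = 0" and "B \<noteq> 0"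
    and min: "\<And>S. S \<noteq> 0 \<Longrightarrow> degree S < degree [:C, B, 0:] \<Longrightarrow> bev x z S \<noteq> 0"
    by (metis (no_types, lifting))
  obtain A' B' C' where "ev A' z * x\<^sup>2 + ev B' z * x + ev C' z = 0" "A' \<noteq> 0"
    using primitive_relation[OF zw R'] Q' by metis
  with \<Phi> rel \<open>B \<noteq> 0\<close> min zw have "degree B \<le> 2" "degree C \<le> 2"
    using primitive_relation_degree_le[of z C B 0 x A' B' C'] by (auto simp: cubic_sqrt_def)
  then obtain b0 b1 b2 c0 c1 c2 where BC: "B = [:b0, b1, b2:]" "C = [:c0, c1, c2:]"
    using poly_eq_pCons2 by metis
  have "ev [:c2, b2:] z * x\<^sup>2 + ev [:c1, b1:] z * x + ev [:c0, b0:] z = 0"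
    using rel unfolding BC by (simp add: power2_eq_square algebra_simps)
  moreover have "\<not> ([:c2, b2:] = 0 \<and> [:c1, b1:] = 0 \<and> [:c0, b0:] = 0)"
    using \<open>B \<noteq> 0\<close> BC by auto
  ultimately obtain h where "h \<noteq> 0"
    and h: "[:c1, b1:]\<^sup>2 - 4 * [:c2, b2:] * [:c0, b0:] = h\<^sup>2 * g"
    by (rule quadratic_relation_discriminant[OF zw R' Q'])
  have g: "degree g = 3" "g \<noteq> 0" using zw by (auto simp: cubic_sqrt_def)
  have "3 \<le> degree (h\<^sup>2 * g)"
    using \<open>h \<noteq> 0\<close> g by (simp add: degree_mult_eq)
  also have "\<dots> \<le> 2"
    unfolding h[symmetric] by (rule degree_le) (auto simp: coeff_pCons numeral_poly power2_eq_square split: nat.splits)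
  finally show False by simp
qed

text \<open>One array of nine coefficients is read as a quadratic in z over k[x] and as a quadratic
  in x over k[z]; its two discriminants are \<open>k\<close> and \<open>l\<close> times the two
  cubics.\<close>

lemma j_eq_of_biquadratic_relation:
  assumes AB: "4 * A ^ 3 + 27 * B\<^sup>2 \<noteq> 0" and AB': "4 * A' ^ 3 + 27 * B'\<^sup>2 \<noteq> 0"
    and xy: "cubic_sqrt [:B, A, 0, 1:] x y" and zw: "cubic_sqrt [:B', A', 0, 1:] z w"
    and R: "R \<noteq> 0" "ev R x * z = ev P x + ev Q x * y" and Q: "Q \<noteq> 0"
    and R': "R' \<noteq> 0" "ev R' z * x = ev P' z + ev Q' z * w" and Q': "Q' \<noteq> 0"
  shows "1728 * (4 * A ^ 3) / (4 * A ^ 3 + 27 * B\<^sup>2) = 1728 * (4 * A' ^ 3) / (4 * A' ^ 3 + 27 * B'\<^sup>2)"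
proof -
  obtain a b c where \<Phi>: "primitive [:c, b, a:]"
    and rel: "ev a x * z\<^sup>2 + ev b x * z + ev c x = 0" and "a \<noteq> 0"
    and min: "\<And>S. S \<noteq> 0 \<Longrightarrow> degree S < degree [:c, b, a:] \<Longrightarrow> bev x z S \<noteq> 0"
    using primitive_relation[OF xy R] Q by metis
  obtain a' b' c' where "ev a' z * x\<^sup>2 + ev b' z * x + ev c' z = 0" "a' \<noteq> 0"
    using primitive_relation[OF zw R'] Q' by metis
  with \<Phi> rel \<open>a \<noteq> 0\<close> min zw have "degree a \<le> 2" "degree b \<le> 2" "degree c \<le> 2"
    using primitive_relation_degree_le[of z c b a x a' b' c'] by (auto simp: cubic_sqrt_def)
  then obtain a0 a1 a2 b0 b1 b2 c0 c1 c2
    where abc: "a = [:a0, a1, a2:]" "b = [:b0, b1, b2:]" "c = [:c0, c1, c2:]"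
    using poly_eq_pCons2 by metis
  \<comment> \<open>Stated for arbitrary generators because it is applied twice, with the roles of x
    and z exchanged.\<close>
  have discriminant: "\<exists>k. k \<noteq> 0 \<and> [:q0, q1, q2:]\<^sup>2 - 4 * [:p0, p1, p2:] * [:r0, r1, r2:] = smult k f"
    if xy: "cubic_sqrt f x y" and R: "R \<noteq> 0" "ev R x * z = ev P x + ev Q x * y" "Q \<noteq> 0"
      and rel: "ev [:p0, p1, p2:] x * z\<^sup>2 + ev [:q0, q1, q2:] x * z + ev [:r0, r1, r2:] x = 0"
      and nz: "\<not> ([:p0, p1, p2:] = 0 \<and> [:q0, q1, q2:] = 0 \<and> [:r0, r1, r2:] = 0)"
    for f x y R P Q z p0 p1 p2 q0 q1 q2 r0 r1 r2
  proof -
    from quadratic_relation_discriminant[OF xy R rel nz] obtain h where "h \<noteq> 0"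
      and h: "[:q0, q1, q2:]\<^sup>2 - 4 * [:p0, p1, p2:] * [:r0, r1, r2:] = h\<^sup>2 * f" by blast
    have "degree (h\<^sup>2 * f) \<le> 4"
      unfolding h[symmetric]
      by (rule degree_le) (auto simp: coeff_pCons numeral_poly power2_eq_square split: nat.splits)
    then obtain k where k: "h = [:k:]"
      using square_times_cubic_degree_le_4 xy unfolding cubic_sqrt_def by blast
    with \<open>h \<noteq> 0\<close> have "k\<^sup>2 \<noteq> 0" by auto
    moreover have "h\<^sup>2 * f = smult (k\<^sup>2) f" by (simp add: k power2_eq_square)
    ultimately show ?thesis using h by metis
  qed
  obtain k where "k \<noteq> 0" and
    k: "[:b0, b1, b2:]\<^sup>2 - 4 * [:a0, a1, a2:] * [:c0, c1, c2:] = smult k [:B, A, 0, 1:]"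
    using discriminant[OF xy R Q rel[unfolded abc]] \<open>a \<noteq> 0\<close> abc by blast
  have "ev [:c2, b2, a2:] z * x\<^sup>2 + ev [:c1, b1, a1:] z * x + ev [:c0, b0, a0:] z = 0"
    using rel unfolding abc by (simp add: power2_eq_square algebra_simps)
  moreover have "\<not> ([:c2, b2, a2:] = 0 \<and> [:c1, b1, a1:] = 0 \<and> [:c0, b0, a0:] = 0)"
    using \<open>a \<noteq> 0\<close> abc by auto
  ultimately obtain l where "l \<noteq> 0" and
    l: "[:c1, b1, a1:]\<^sup>2 - 4 * [:c2, b2, a2:] * [:c0, b0, a0:] = smult l [:B', A', 0, 1:]"
    using discriminant[OF zw R' Q'] by blast
  have k': "a1\<^sup>2 - 4 * a2 * a0 = 0" "2 * a1 * b1 - 4 * (a2 * b0 + b2 * a0) = l"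
    "b1\<^sup>2 + 2 * c1 * a1 - 4 * (c2 * a0 + b2 * b0 + a2 * c0) = 0"
    "2 * c1 * b1 - 4 * (c2 * b0 + b2 * c0) = l * A'" "c1\<^sup>2 - 4 * c2 * c0 = l * B'"
    using biquadratic_coeff[OF l] by (simp_all add: algebra_simps)
  \<comment> \<open>With vanishing coefficients of degree 4 and 2, I reduces to
    \<open>-3 d3 d1\<close> and J to \<open>-27 d0 d3^2\<close>.\<close>
  have "3 * (k\<^sup>2 * A) = 3 * (l\<^sup>2 * A')"
    using biquadratic_discriminant_invariants(1)[where ?a0.0 = a0 and ?a1.0 = a1 and ?a2.0 = a2 and ?b0.0 = b0 and ?b1.0 = b1
          and ?b2.0 = b2 and ?c0.0 = c0 and ?c1.0 = c1 and ?c2.0 = c2]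
    unfolding biquadratic_coeff[OF k] k' by (simp add: power2_eq_square mult.assoc)
  moreover have "27 * (k ^ 3 * B) = 27 * (l ^ 3 * B')"
    using biquadratic_discriminant_invariants(2)[where ?a0.0 = a0 and ?a1.0 = a1 and ?a2.0 = a2 and ?b0.0 = b0 and ?b1.0 = b1
          and ?b2.0 = b2 and ?c0.0 = c0 and ?c1.0 = c1 and ?c2.0 = c2]
    unfolding biquadratic_coeff[OF k] k' by (simp add: power2_eq_square power3_eq_cube algebra_simps)
  ultimately show ?thesis
    using \<open>k \<noteq> 0\<close> \<open>l \<noteq> 0\<close> AB AB' by (intro j_eq_of_scaled[of k l]) auto
qed

end

text \<open>The \<open>q\<^sub>i\<close> are the coefficients of \<open>r (p\<^sup>3 + A p r\<^sup>2 + B r\<^sup>3)\<close> for \<open>p = p\<^sub>0 + p\<^sub>1 X\<close> and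
  \<open>r = r\<^sub>0 + r\<^sub>1 X\<close>: the invariants \<open>I\<close> and \<open>J\<close> have weights \<open>4\<close> and \<open>6\<close>.\<close>

lemma moebius_quartic_invariants:
  fixes p0 p1 r0 r1 A B :: "'a::idom"
  defines "q4 \<equiv> r1 * p1 ^ 3 + A * p1 * r1 ^ 3 + B * r1 ^ 4"
    and "q3 \<equiv> r0 * p1 ^ 3 + 3 * r1 * p1\<^sup>2 * p0 + A * (p0 * r1 ^ 3 + 3 * p1 * r1\<^sup>2 * r0) + 4 * B * r1 ^ 3 * r0"
    and "q2 \<equiv> 3 * r0 * p1\<^sup>2 * p0 + 3 * r1 * p1 * p0\<^sup>2 + A * (3 * p0 * r1\<^sup>2 * r0 + 3 * p1 * r1 * r0\<^sup>2)
          + 6 * B * r1\<^sup>2 * r0\<^sup>2"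
    and "q1 \<equiv> 3 * r0 * p1 * p0\<^sup>2 + r1 * p0 ^ 3 + A * (3 * p0 * r1 * r0\<^sup>2 + p1 * r0 ^ 3) + 4 * B * r1 * r0 ^ 3"
    and "q0 \<equiv> r0 * p0 ^ 3 + A * p0 * r0 ^ 3 + B * r0 ^ 4"
  shows "12 * q4 * q0 - 3 * q3 * q1 + q2\<^sup>2 = - 3 * (p1 * r0 - p0 * r1) ^ 4 * A"
    and "72 * q4 * q2 * q0 + 9 * q3 * q2 * q1 - 27 * q4 * q1\<^sup>2 - 27 * q0 * q3\<^sup>2 - 2 * q2 ^ 3
      = - 27 * (p1 * r0 - p0 * r1) ^ 6 * B"
  unfolding assms by algebra+

lemma moebius_quartic_coeff:
  fixes p0 p1 r0 r1 A B :: "'a::idom"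
  assumes "[:r0, r1:] * ([:p0, p1:] ^ 3 + [:A':] * [:p0, p1:] * [:r0, r1:]\<^sup>2 + [:B':] * [:r0, r1:] ^ 3)
    = smult k [:B, A, 0, 1:]"
  shows "r1 * p1 ^ 3 + A' * p1 * r1 ^ 3 + B' * r1 ^ 4 = 0"
    and "r0 * p1 ^ 3 + 3 * r1 * p1\<^sup>2 * p0 + A' * (p0 * r1 ^ 3 + 3 * p1 * r1\<^sup>2 * r0) + 4 * B' * r1 ^ 3 * r0 = k"
    and "3 * r0 * p1\<^sup>2 * p0 + 3 * r1 * p1 * p0\<^sup>2 + A' * (3 * p0 * r1\<^sup>2 * r0 + 3 * p1 * r1 * r0\<^sup>2)
          + 6 * B' * r1\<^sup>2 * r0\<^sup>2 = 0"
    and "3 * r0 * p1 * p0\<^sup>2 + r1 * p0 ^ 3 + A' * (3 * p0 * r1 * r0\<^sup>2 + p1 * r0 ^ 3) + 4 * B' * r1 * r0 ^ 3 = k * A"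
    and "r0 * p0 ^ 3 + A' * p0 * r0 ^ 3 + B' * r0 ^ 4 = k * B"
  using arg_cong[OF assms, of "\<lambda>p. coeff p 4"] arg_cong[OF assms, of "\<lambda>p. coeff p 3"]
    arg_cong[OF assms, of "\<lambda>p. coeff p 2"] arg_cong[OF assms, of "\<lambda>p. coeff p 1"]
    arg_cong[OF assms, of "\<lambda>p. coeff p 0"]
  by (simp_all add: eval_nat_numeral algebra_simps)

lemma degree_moebius_quartic:
  fixes p r :: "'a::idom poly"
  assumes "degree p \<le> 1" and "degree r \<le> 1"
  shows "degree (r * (p ^ 3 + [:A:] * p * r\<^sup>2 + [:B:] * r ^ 3)) \<le> 4"
proof -
  have le: "degree (s * t) \<le> m + n" if "degree s \<le> m" "degree t \<le> n" for s t :: "'a poly" and m n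
    using degree_mult_le[of s t] that by linarith
  have pow: "degree (s ^ n) \<le> n" if "degree s \<le> 1" for s :: "'a poly" and n
    using degree_power_le[of s n] that mult_le_mono1[of "degree s" 1 n] by linarith
  have "degree (p ^ 3 + [:A:] * p * r\<^sup>2 + [:B:] * r ^ 3) \<le> 3"
    using le[OF le[of "[:A:]" 0 p 1] pow[of r 2]] le[of "[:B:]" 0 "r ^ 3" 3] pow[of p 3] pow[of r 3] assms
    by (intro degree_add_le) auto
  from le[OF assms(2) this] show ?thesis by simp
qed

context embedded_field
begin

lemma ev_in_adjoin: "x \<in> S \<Longrightarrow> ev p x \<in> adjoin \<iota> S"
  by (induction p) (auto intro: adjoin_closed subset_adjoin)

lemma sqrt_not_in_adjoin:
  assumes xy: "cubic_sqrt f x y"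
  shows "y \<notin> adjoin \<iota> {x}"
proof
  assume "y \<in> adjoin \<iota> {x}"
  \<comment> \<open>Viewing k(x) as k(x, 0) makes the normal form with f = 0 available.\<close>
  then have "y \<in> adjoin \<iota> {x, 0}"
    using adjoin_subsetI[of "{x}" \<iota> "{x, 0}"] by (auto intro: subset_adjoin)
  moreover have "transcendental_over \<iota> x" using xy by (simp add: cubic_sqrt_def)
  ultimately obtain P Q R where "R \<noteq> 0" and "ev R x * y = ev P x + ev Q x * 0"
    by (elim adjoin_sqrt_cases[where f = 0, rotated 3]) auto
  then have "ev (- P) x + ev R x * y = 0" by simp
  from sqrt_independent[OF xy this] \<open>R \<noteq> 0\<close> show False by simp
qed

text \<open>Here z = p / r with p and r of degree at most one in x. Substituting into the cubic of w
  gives a binary quartic that must be a constant multiple of the cubic of y, and I and J of this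
  quartic carry powers 4 and 6 of the determinant \<open>p1 r0 - p0 r1\<close>.\<close>

lemma j_eq_of_moebius_relation:
  assumes AB: "4 * A ^ 3 + 27 * B\<^sup>2 \<noteq> 0" and AB': "4 * A' ^ 3 + 27 * B'\<^sup>2 \<noteq> 0"
    and xy: "cubic_sqrt [:B, A, 0, 1:] x y" and zw: "cubic_sqrt [:B', A', 0, 1:] z w"
    and eq: "adjoin \<iota> {x, y} = adjoin \<iota> {z, w}"
    and R: "R \<noteq> 0" "ev R x * z = ev P x" and R': "R' \<noteq> 0" "ev R' z * x = ev P' z"
  shows "1728 * (4 * A ^ 3) / (4 * A ^ 3 + 27 * B\<^sup>2) = 1728 * (4 * A' ^ 3) / (4 * A' ^ 3 + 27 * B'\<^sup>2)"
proof -
  let ?f = "[:B, A, 0, 1:]"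
  have x: "transcendental_over \<iota> x" and y: "y\<^sup>2 = ev ?f x" and f: "degree ?f = 3" "no_double_root ?f"
    and z: "transcendental_over \<iota> z" and w: "w\<^sup>2 = ev [:B', A', 0, 1:] z"
    using xy zw unfolding cubic_sqrt_def by blast+
  have "ev R x * z = ev P x + ev 0 x * y" using R by simp
  from primitive_relation[OF xy R(1) this] obtain b c where \<Phi>: "primitive [:c, b, 0:]"
    and rel: "ev 0 x * z\<^sup>2 + ev b x * z + ev c x = 0" and "b \<noteq> 0"
    and min: "\<And>S. S \<noteq> 0 \<Longrightarrow> degree S < degree [:c, b, 0:] \<Longrightarrow> bev x z S \<noteq> 0"
    by (metis (no_types, lifting))
  have "ev R' z * x = ev P' z + ev 0 z * w" using R' by simp
  from primitive_relation[OF zw R'(1) this] obtain b' c' where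
    "ev 0 z * x\<^sup>2 + ev b' z * x + ev c' z = 0" "b' \<noteq> 0"
    by (metis (no_types, lifting))
  then have "degree b \<le> 1" "degree c \<le> 1"
    using primitive_relation_degree_le[OF z \<Phi> rel min, of 0 b' c'] \<open>b \<noteq> 0\<close> by auto
  moreover have "p = [:coeff p 0, coeff p 1:]" if "degree p \<le> 1" for p :: "'k poly"
    using that by (intro poly_eqI) (auto simp: coeff_pCons coeff_eq_0 split: nat.splits)
  ultimately obtain r0 r1 p0 p1 where b: "b = [:r0, r1:]" and c: "- c = [:p0, p1:]"
    by (metis degree_minus)
  let ?p = "[:p0, p1:]" and ?r = "[:r0, r1:]"
  have r: "ev ?r x * z = ev ?p x" using rel unfolding b[symmetric] c[symmetric]
    by (simp add: eq_neg_iff_add_eq_0)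
  have "?r \<noteq> 0" using \<open>b \<noteq> 0\<close> b by simp
  \<comment> \<open>This is \<open>r^4 w^2\<close>: the extra factor r turns the denominator r^3
    into a square, so that \<open>q\<close> differs from w^2 by a square.\<close>
  define q where "q = ?r * (?p ^ 3 + [:A':] * ?p * ?r\<^sup>2 + [:B':] * ?r ^ 3)"
  have "w \<in> adjoin \<iota> {x, y}" unfolding eq by (rule subset_adjoin) simp
  then obtain M N S where S: "S \<noteq> 0" "ev S x * w = ev M x + ev N x * y"
    by (rule adjoin_cubic_sqrt_cases[OF xy])
  have "ev (S\<^sup>2 * q) x = ((ev ?r x)\<^sup>2 * (ev S x * w))\<^sup>2"
  proof -
    have "ev q x = (ev ?r x) ^ 4 * w\<^sup>2"
      unfolding w q_def ev_mult ev_add ev_power r[symmetric] by simp algebra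
    then show ?thesis by (simp add: algebra_simps power2_eq_square eval_nat_numeral del: ev_pCons)
  qed
  then have "ev (S\<^sup>2 * q - ?r ^ 4 * (M\<^sup>2 + N\<^sup>2 * ?f)) x + ev (- (2 * ?r ^ 4 * M * N)) x * y = 0"
    unfolding S(2) ev_diff ev_add ev_mult ev_power ev_uminus ev_numeral y[symmetric] by algebra
  note ind = sqrt_independent[OF xy this]
  \<comment> \<open>Otherwise z and w both lie in k(x), and then so does y, as z and w generate the
    whole field.\<close>
  have "N \<noteq> 0"
  proof
    assume "N = 0"
    have nz: "ev S x \<noteq> 0" "ev ?r x \<noteq> 0" using S \<open>?r \<noteq> 0\<close> ev_eq_0_iff[OF x] by blast+
    then have "w = ev M x / ev S x" "z = ev ?p x / ev ?r x"
      using S(2) r \<open>N = 0\<close> by (simp_all add: field_simps del: ev_pCons)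
    then have "{z, w} \<subseteq> adjoin \<iota> {x}"
      by (auto intro!: adjoin_closed(8) ev_in_adjoin simp del: ev_pCons)
    then have "adjoin \<iota> {x, y} \<subseteq> adjoin \<iota> {x}" unfolding eq by (rule adjoin_subsetI)
    then have "y \<in> adjoin \<iota> {x}" using subset_adjoin[of y "{x, y}" \<iota>] by blast
    with sqrt_not_in_adjoin[OF xy] show False by blast
  qed
  with ind(2) \<open>?r \<noteq> 0\<close> have "M = 0"
    by (metis mult_eq_0_iff neg_equal_0_iff_equal power_not_zero zero_neq_numeral)
  with ind(1) have Sq: "S\<^sup>2 * q = (?r\<^sup>2 * N)\<^sup>2 * ?f"
    by (simp add: power_mult_distrib mult.assoc flip: power_mult del: mult_pCons_left mult_pCons_right)
  from square_denominator_cancel[OF f(2) S(1) this] obtain h where h: "q = h\<^sup>2 * ?f" by blast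
  have "degree q \<le> 4" unfolding q_def by (rule degree_moebius_quartic) auto
  then obtain l where l: "h = [:l:]"
    using square_times_cubic_degree_le_4[of h ?f] f h by metis
  define k where "k = l\<^sup>2"
  have q: "q = smult k ?f" unfolding h l k_def by (simp add: power2_eq_square)
  have "(?r\<^sup>2 * N)\<^sup>2 * ?f \<noteq> 0" using \<open>?r \<noteq> 0\<close> \<open>N \<noteq> 0\<close> by (simp del: mult_pCons_left mult_pCons_right)
  then have "k \<noteq> 0" unfolding Sq[symmetric] q by auto
  note coeffs = moebius_quartic_coeff[OF q[unfolded q_def]]
  let ?d = "p1 * r0 - p0 * r1"
  have I: "k\<^sup>2 * A = (?d\<^sup>2)\<^sup>2 * A'"
    using moebius_quartic_invariants(1)[where ?p0.0 = p0 and ?p1.0 = p1 and ?r0.0 = r0 and ?r1.0 = r1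
        and A = A' and B = B']
    unfolding coeffs by (simp add: power2_eq_square power4_eq_xxxx mult.assoc)
  have J: "k ^ 3 * B = (?d\<^sup>2) ^ 3 * B'"
    using moebius_quartic_invariants(2)[where ?p0.0 = p0 and ?p1.0 = p1 and ?r0.0 = r0 and ?r1.0 = r1
        and A = A' and B = B']
    unfolding coeffs by (simp add: power2_eq_square power3_eq_cube eval_nat_numeral mult.assoc) (simp add: algebra_simps)
  \<comment> \<open>A zero determinant would give A = B = 0 through \<open>I\<close> and
    \<open>J\<close>.\<close>
  have "?d \<noteq> 0" using I J AB \<open>k \<noteq> 0\<close> by auto
  with I J AB AB' \<open>k \<noteq> 0\<close> show ?thesis by (intro j_eq_of_scaled[of k "?d\<^sup>2"]) auto
qed

theorem weierstrass_model_j_unique: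
  assumes "weierstrass_model \<iota> E A B" and "weierstrass_model \<iota> E A' B'"
  shows "1728 * (4 * A ^ 3) / (4 * A ^ 3 + 27 * B\<^sup>2) = 1728 * (4 * A' ^ 3) / (4 * A' ^ 3 + 27 * B'\<^sup>2)"
proof -
  obtain x y z w where AB: "4 * A ^ 3 + 27 * B\<^sup>2 \<noteq> 0" "4 * A' ^ 3 + 27 * B'\<^sup>2 \<noteq> 0"
    and xy: "cubic_sqrt [:B, A, 0, 1:] x y" and zw: "cubic_sqrt [:B', A', 0, 1:] z w"
    and E: "E = adjoin \<iota> {x, y}" "E = adjoin \<iota> {z, w}"
    using assms unfolding weierstrass_model_def by (metis weierstrass_cubic_sqrt)
  have "z \<in> adjoin \<iota> {x, y}" "x \<in> adjoin \<iota> {z, w}"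
    unfolding E[symmetric] by (simp add: E(2) subset_adjoin) (simp add: E(1) subset_adjoin)
  then obtain P Q R P' Q' R' where R: "R \<noteq> 0" "ev R x * z = ev P x + ev Q x * y"
    and R': "R' \<noteq> 0" "ev R' z * x = ev P' z + ev Q' z * w"
    by (metis adjoin_cubic_sqrt_cases[OF xy] adjoin_cubic_sqrt_cases[OF zw])
  show ?thesis
  proof (cases "Q = 0 \<or> Q' = 0")
    case True
    have "Q' = 0" if "Q = 0"
      by (rule rational_in_both_directions[OF xy zw R(1) _ R']) (use R that in simp)
    moreover have "Q = 0" if "Q' = 0"
      by (rule rational_in_both_directions[OF zw xy R'(1) _ R]) (use R' that in simp)
    ultimately have "Q = 0" "Q' = 0" using True by blast+
    with R R' show ?thesis
      using E by (intro j_eq_of_moebius_relation[OF AB xy zw _ R(1) _ R'(1)]) auto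
  next
    case False
    then show ?thesis by (intro j_eq_of_biquadratic_relation[OF AB xy zw R _ R']) auto
  qed
qed

corollary j_invariant_weierstrass:
  assumes "weierstrass_model \<iota> E A B"
  shows "j_invariant \<iota> E = 1728 * (4 * A ^ 3) / (4 * A ^ 3 + 27 * B\<^sup>2)"
  unfolding j_invariant_def
  by (rule the_equality) (use assms weierstrass_model_j_unique in blast)+

subsection \<open>The two subfields of degree three\<close>

text \<open>Over an algebraically closed field, p(U) is a nonzero constant times a product of
  factors U - c, so U is transcendental unless it is constant. U = c would mean N = c M; evaluating
  at \<open>e\<close> gives c = 0, contrary to N being nonzero.\<close>

lemma transcendental_quotient:
  assumes X: "transcendental_over \<iota> X" and U: "U * ev M X = ev N X"
    and e: "poly N e = 0" "poly M e \<noteq> 0" and N: "N \<noteq> 0"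
  shows "transcendental_over \<iota> U"
  unfolding transcendental_over_def
proof (intro allI impI)
  fix p :: "'k poly"
  assume "p \<noteq> 0"
  then show "ev p U \<noteq> 0"
  proof (induction "degree p" arbitrary: p rule: less_induct)
    case less
    show ?case
    proof (cases "degree p = 0")
      case True
      with less.prems show ?thesis by (auto elim: degree_eq_zeroE)
    next
      case False
      then obtain c where "poly p c = 0" using alg_closed_imp_poly_has_root[of p] by auto
      then obtain s where s: "p = [:- c, 1:] * s" by (auto simp: poly_eq_0_iff_dvd)
      with less.prems have "s \<noteq> 0" by auto
      moreover then have "degree s < degree p"
        unfolding s by (simp add: degree_mult_eq del: mult_pCons_left)
      ultimately have "ev s U \<noteq> 0" using less.hyps by blast
      moreover have "U \<noteq> \<iota> c"
      proof
        assume "U = \<iota> c"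
        with U have "ev (smult c M) X = ev N X" by simp
        then have "smult c M = N" using ev_eq_iff[OF X] by blast
        with e N show False by auto
      qed
      ultimately show ?thesis unfolding s ev_mult by simp
    qed
  qed
qed

lemma adjoin_affine:
  assumes "\<alpha> \<noteq> 0" and "\<gamma> \<noteq> 0"
  shows "adjoin \<iota> {\<iota> \<alpha> * U + \<iota> \<beta>, \<iota> \<gamma> * V} = adjoin \<iota> {U, V}"
proof
  show "adjoin \<iota> {\<iota> \<alpha> * U + \<iota> \<beta>, \<iota> \<gamma> * V} \<subseteq> adjoin \<iota> {U, V}"
  proof (rule adjoin_subsetI)
    have "U \<in> adjoin \<iota> {U, V}" "V \<in> adjoin \<iota> {U, V}" by (simp_all add: subset_adjoin)
    then show "{\<iota> \<alpha> * U + \<iota> \<beta>, \<iota> \<gamma> * V} \<subseteq> adjoin \<iota> {U, V}"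
      by (auto intro: adjoin_closed(4,7,9))
  qed
  let ?S = "{\<iota> \<alpha> * U + \<iota> \<beta>, \<iota> \<gamma> * V}"
  have "U = ((\<iota> \<alpha> * U + \<iota> \<beta>) - \<iota> \<beta>) / \<iota> \<alpha>" "V = (\<iota> \<gamma> * V) / \<iota> \<gamma>"
    using assms by simp_all
  moreover have "((\<iota> \<alpha> * U + \<iota> \<beta>) - \<iota> \<beta>) / \<iota> \<alpha> \<in> adjoin \<iota> ?S" "(\<iota> \<gamma> * V) / \<iota> \<gamma> \<in> adjoin \<iota> ?S"
    by (intro adjoin_closed(3,8,9) subset_adjoin; simp)+
  ultimately have "U \<in> adjoin \<iota> ?S" "V \<in> adjoin \<iota> ?S" by simp_all
  then show "adjoin \<iota> {U, V} \<subseteq> adjoin \<iota> ?S" by (intro adjoin_subsetI) blast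
qed

text \<open>Multiplying by 729 c3^2 and substituting x = 9 c3 U + 3 c2, y = 27 c3 V depresses the
  cubic without any division.\<close>

lemma j_invariant_cubic:
  assumes U: "transcendental_over \<iota> U" and V: "V\<^sup>2 = ev [:c0, c1, c2, c3:] U"
    and A: "A = 81 * c1 * c3 - 27 * c2\<^sup>2" and B: "B = 729 * c0 * c3\<^sup>2 - 243 * c1 * c2 * c3 + 54 * c2 ^ 3"
    and nz: "4 * A ^ 3 + 27 * B\<^sup>2 \<noteq> 0"
  shows "j_invariant \<iota> (adjoin \<iota> {U, V}) = 1728 * (4 * A ^ 3) / (4 * A ^ 3 + 27 * B\<^sup>2)"
proof -
  \<comment> \<open>For c3 = 0 one has A = -27 c2^2 and B = 54 c2^3, and the discriminant expression
    cancels.\<close>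
  have "c3 \<noteq> 0" using nz unfolding A B by (auto simp: power_mult_distrib)
  let ?x = "\<iota> (9 * c3) * U + \<iota> (3 * c2)" and ?y = "\<iota> (27 * c3) * V"
  have "transcendental_over \<iota> ?x"
    by (rule transcendental_quotient[OF U, where M = 1 and N = "[:3 * c2, 9 * c3:]" and e = "- c2 / (3 * c3)"])
      (use \<open>c3 \<noteq> 0\<close> in \<open>auto simp: field_simps\<close>)
  moreover have "?y\<^sup>2 = ev [:B, A, 0, 1:] ?x"
    unfolding power_mult_distrib V A B by simp algebra
  moreover have "adjoin \<iota> {U, V} = adjoin \<iota> {?x, ?y}"
    using \<open>c3 \<noteq> 0\<close> by (intro adjoin_affine[symmetric]) auto
  ultimately have "weierstrass_model \<iota> (adjoin \<iota> {U, V}) A B"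
    using nz unfolding weierstrass_model_def by blast
  then show ?thesis by (rule j_invariant_weierstrass)
qed

lemma j_invariant_E1:
  assumes X: "transcendental_over \<iota> X" and Y: "Y\<^sup>2 = ev (F_poly a b) X * ev (G_poly b) X"
    and D: "D = 4 * a ^ 3 + 27 - 18 * a * b - a\<^sup>2 * b\<^sup>2 + 4 * b ^ 3" and "D \<noteq> 0" and "b ^ 3 - 27 \<noteq> 0"
  shows "j_invariant \<iota> (E1 \<iota> a b X Y)
    = 16 * (a\<^sup>2 * b ^ 4 + 216 * a\<^sup>2 * b - 126 * a * b ^ 3 - 972 * a + 12 * b ^ 5 + 405 * b\<^sup>2) ^ 3
      / ((b ^ 3 - 27) ^ 3 * D\<^sup>2)" (is "_ = 16 * ?Q ^ 3 / _")
proof -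
  define F where "F = ev (F_poly a b) X"
  define P where "P = ev [:- 2, - b, 0, 1:] X"
  define U where "U = X\<^sup>2 / F"
  define V where "V = Y * P / F\<^sup>2"
  have "F \<noteq> 0" unfolding F_def ev_eq_0_iff[OF X] by (simp add: F_poly_def)
  let ?c1 = "b\<^sup>2 - 12 * a" and ?c2 = "- 18 * b - 2 * a * b\<^sup>2 + 12 * a\<^sup>2"
  have "V\<^sup>2 = F * ev (G_poly b) X * P\<^sup>2 / F ^ 4"
    unfolding V_def power_divide power_mult_distrib Y F_def[symmetric] by simp
  \<comment> \<open>A cubic form in \<open>F\<close> and \<open>X^2\<close>, the denominator and
    numerator of \<open>U\<close>; division by \<open>F^3\<close> leaves a cubic in
    \<open>U\<close>. Its leading coefficient \<open>- D\<close> is the discriminant of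
    \<open>F_poly a b\<close>.\<close>
  also have "ev (G_poly b) X * P\<^sup>2
      = 4 * F ^ 3 + \<iota> ?c1 * X\<^sup>2 * F\<^sup>2 + \<iota> ?c2 * X ^ 4 * F + \<iota> (- D) * X ^ 6"
    unfolding F_def P_def G_poly_def F_poly_def D by simp algebra
  then have "F * ev (G_poly b) X * P\<^sup>2 / F ^ 4 = ev [:4, ?c1, ?c2, - D:] U"
    using \<open>F \<noteq> 0\<close> by (simp add: U_def field_simps eval_nat_numeral)
  finally have V: "V\<^sup>2 = ev [:4, ?c1, ?c2, - D:] U" .
  have U: "transcendental_over \<iota> U"
    by (rule transcendental_quotient[OF X, where M = "F_poly a b" and N = "[:0, 0, 1:]" and e = 0])
      (use \<open>F \<noteq> 0\<close> in \<open>auto simp: U_def F_def F_poly_def power2_eq_square simp del: ev_pCons\<close>, simp)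
  let ?A = "81 * ?c1 * (- D) - 27 * ?c2\<^sup>2" and ?B = "729 * 4 * (- D)\<^sup>2 - 243 * ?c1 * ?c2 * (- D) + 54 * ?c2 ^ 3"
  have A: "?A = - 27 * ?Q" unfolding D by algebra
  have disc: "4 * ?A ^ 3 + 27 * ?B\<^sup>2 = - 8503056 * ((b ^ 3 - 27) ^ 3 * D\<^sup>2)" unfolding D by algebra
  have nz: "4 * ?A ^ 3 + 27 * ?B\<^sup>2 \<noteq> 0"
    unfolding disc using \<open>D \<noteq> 0\<close> \<open>b ^ 3 - 27 \<noteq> 0\<close> by simp
  have "j_invariant \<iota> (adjoin \<iota> {U, V}) = 1728 * (4 * ?A ^ 3) / (4 * ?A ^ 3 + 27 * ?B\<^sup>2)"
    by (rule j_invariant_cubic[OF U V refl refl nz])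
  also have "\<dots> = 1728 * (4 * (- 27 * ?Q) ^ 3) / (- 8503056 * ((b ^ 3 - 27) ^ 3 * D\<^sup>2))"
    unfolding disc unfolding A ..
  also have "\<dots> = 16 * ?Q ^ 3 / ((b ^ 3 - 27) ^ 3 * D\<^sup>2)"
    unfolding power_mult_distrib by simp
  finally show ?thesis by (simp add: E1_def Let_def U_def V_def F_def P_def)
qed


text \<open>In the coordinates \<open>b\<^sup>2 H U\<^sub>2\<close> and \<open>(b\<^sup>3 - 27) V\<^sub>2\<close> the cubic has polynomial coefficients and
  leading coefficient \<open>-1\<close>.\<close>

lemma j_invariant_E2_generic:
  assumes X: "transcendental_over \<iota> X" and Y: "Y\<^sup>2 = ev (F_poly a b) X * ev (G_poly b) X"
    and D: "D = 4 * a ^ 3 + 27 - 18 * a * b - a\<^sup>2 * b\<^sup>2 + 4 * b ^ 3" and "D \<noteq> 0"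
    and w: "w = b ^ 3 - 27" and "w \<noteq> 0" and "b \<noteq> 0" and r: "r\<^sup>2 = 27 - b ^ 3"
    and H: "H = b ^ 3 - 4 * a * b + 9" and "H \<noteq> 0"
  shows "j_invariant \<iota> (E2 \<iota> a b r q X Y) = - 256 * (a\<^sup>2 - 3 * b) ^ 3 / D"
proof -
  define G where "G = ev (G_poly b) X"
  define P where "P = ev [:1, b, - (b\<^sup>2 - 4 * a), 4 * a * b - 8 - b ^ 3:] X"
  define N where "N = [:3, b:]\<^sup>2 * [:b\<^sup>2 - 3 * a, H:]"
  define U where "U = (X - \<iota> (- 3 / b))\<^sup>2 * (X - \<iota> ((3 * a - b\<^sup>2) / H)) / G"
  define V where "V = \<iota> r * Y * P / G\<^sup>2"
  define U' where "U' = ev N X / G"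
  define V' where "V' = \<iota> w * V"
  have "G \<noteq> 0" unfolding G_def ev_eq_0_iff[OF X] by (simp add: G_poly_def)
  have "ev N X = \<iota> (b\<^sup>2 * H) * ((X - \<iota> (- 3 / b))\<^sup>2 * (X - \<iota> ((3 * a - b\<^sup>2) / H)))"
    unfolding N_def ev_mult ev_power using \<open>b \<noteq> 0\<close> \<open>H \<noteq> 0\<close>
    by (simp add: field_simps power2_eq_square)
  then have U': "U' = \<iota> (b\<^sup>2 * H) * U + \<iota> 0" by (simp add: U'_def U_def)
  let ?c0 = "(2 * b ^ 3 - 9 * a * b + 27) ^ 3"
  let ?c1 = "- 729 * b - 189 * b ^ 4 - b ^ 7 + 972 * a * b\<^sup>2 + 18 * a * b ^ 5 - 729 * a\<^sup>2 - 54 * a\<^sup>2 * b ^ 3"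
  let ?c2 = "27 * b\<^sup>2 - 54 * a - a * b ^ 3"
  have "V'\<^sup>2 = \<iota> (w\<^sup>2 * r\<^sup>2) * ev (F_poly a b) X * G * P\<^sup>2 / G ^ 4"
    unfolding V'_def V_def power_divide power_mult_distrib Y G_def[symmetric] by simp
  also have "\<iota> (w\<^sup>2 * r\<^sup>2) * ev (F_poly a b) X * P\<^sup>2
      = \<iota> ?c0 * G ^ 3 + \<iota> ?c1 * ev N X * G\<^sup>2 + \<iota> ?c2 * (ev N X)\<^sup>2 * G - (ev N X) ^ 3"
    unfolding r G_def P_def G_poly_def F_poly_def N_def w H by simp algebra
  then have "\<iota> (w\<^sup>2 * r\<^sup>2) * ev (F_poly a b) X * G * P\<^sup>2 / G ^ 4 = ev [:?c0, ?c1, ?c2, - 1:] U'"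
    using \<open>G \<noteq> 0\<close> by (simp add: U'_def field_simps eval_nat_numeral)
  finally have V': "V'\<^sup>2 = ev [:?c0, ?c1, ?c2, - 1:] U'" .
  \<comment> \<open>The double root -3/b of \<open>N\<close> serves as the point that separates
    numerator from denominator; b^3 \<noteq> 27 keeps \<open>G_poly b\<close> from vanishing
    there.\<close>
  have "poly (G_poly b) (- 3 / b) = 4 * w / b ^ 3"
    using \<open>b \<noteq> 0\<close> by (simp add: G_poly_def w field_simps eval_nat_numeral)
  moreover have "poly N (- 3 / b) = 0" using \<open>b \<noteq> 0\<close> by (simp add: N_def poly_power)
  moreover have "N \<noteq> 0"
    using \<open>b \<noteq> 0\<close> \<open>H \<noteq> 0\<close> unfolding N_def by (simp del: mult_pCons_left mult_pCons_right)
  ultimately have U'': "transcendental_over \<iota> U'"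
    using \<open>b \<noteq> 0\<close> \<open>w \<noteq> 0\<close> \<open>G \<noteq> 0\<close>
    by (intro transcendental_quotient[OF X, where M = "G_poly b" and N = N and e = "- 3 / b"])
      (auto simp: U'_def G_def simp del: ev_pCons)
  let ?A = "81 * ?c1 * (- 1) - 27 * ?c2\<^sup>2" and ?B = "729 * ?c0 * (- 1)\<^sup>2 - 243 * ?c1 * ?c2 * (- 1) + 54 * ?c2 ^ 3"
  have A: "?A = - 27 * (a\<^sup>2 - 3 * b) * w\<^sup>2" unfolding w by algebra
  have disc: "4 * ?A ^ 3 + 27 * ?B\<^sup>2 = 531441 * D * w ^ 6" unfolding D w by algebra
  have nz: "4 * ?A ^ 3 + 27 * ?B\<^sup>2 \<noteq> 0"
    unfolding disc using \<open>D \<noteq> 0\<close> \<open>w \<noteq> 0\<close> by simp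
  have "j_invariant \<iota> (adjoin \<iota> {U', V'}) = 1728 * (4 * ?A ^ 3) / (4 * ?A ^ 3 + 27 * ?B\<^sup>2)"
    by (rule j_invariant_cubic[OF U'' V' refl refl nz])
  also have "\<dots> = 1728 * (4 * (- 27 * (a\<^sup>2 - 3 * b) * w\<^sup>2) ^ 3) / (531441 * D * w ^ 6)"
    unfolding disc unfolding A ..
  also have "\<dots> = - 256 * (a\<^sup>2 - 3 * b) ^ 3 / D"
    using \<open>w \<noteq> 0\<close> unfolding power_mult_distrib by simp
  also have "adjoin \<iota> {U', V'} = adjoin \<iota> {U, V}"
    unfolding U' V'_def using \<open>b \<noteq> 0\<close> \<open>H \<noteq> 0\<close> \<open>w \<noteq> 0\<close> by (intro adjoin_affine) auto
  also have "adjoin \<iota> {U, V} = E2 \<iota> a b r q X Y"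
    using \<open>H \<noteq> 0\<close> unfolding E2_def Let_def U_def V_def G_def P_def H by simp
  finally show ?thesis .
qed

text \<open>When b^3 - 4ab + 9 = 0, the root t of the numerator of U2 moves to infinity and only the
  double factor survives. The relation 4ab = b^3 + 9 removes a from the cubic, and brings it back to
  reach the generic formula for j.\<close>

lemma j_invariant_E2_degenerate:
  assumes X: "transcendental_over \<iota> X" and Y: "Y\<^sup>2 = ev (F_poly a b) X * ev (G_poly b) X"
    and D: "D = 4 * a ^ 3 + 27 - 18 * a * b - a\<^sup>2 * b\<^sup>2 + 4 * b ^ 3" and "D \<noteq> 0"
    and "b ^ 3 - 27 \<noteq> 0" and "b \<noteq> 0" and q: "q\<^sup>2 = b"
    and H: "b ^ 3 - 4 * a * b + 9 = 0"
  shows "j_invariant \<iota> (E2 \<iota> a b r q X Y) = - 256 * (a\<^sup>2 - 3 * b) ^ 3 / D"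
proof -
  define G where "G = ev (G_poly b) X"
  define P where "P = ev [:b, b\<^sup>2, 9, b:] X"
  define N where "N = [:3, b:]\<^sup>2"
  define U where "U = (\<iota> b * X + 3)\<^sup>2 / (\<iota> b ^ 2 * G)"
  define V where "V = \<iota> (8 / b * q) * Y * P / G\<^sup>2"
  define U' where "U' = ev N X / G"
  define V' where "V' = \<iota> b * V"
  have "G \<noteq> 0" unfolding G_def ev_eq_0_iff[OF X] by (simp add: G_poly_def)
  have U': "U' = \<iota> (b\<^sup>2) * U + \<iota> 0"
    using \<open>b \<noteq> 0\<close> by (simp add: U'_def U_def N_def ev_power algebra_simps)
  have a: "\<iota> (4 * a * b) = \<iota> (b ^ 3 + 9)" using H by (simp add: algebra_simps del: emb_add emb_mult)
  have "V' = \<iota> (8 * q) * Y * P / G\<^sup>2" using \<open>b \<noteq> 0\<close> by (simp add: V'_def V_def)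
  then have "V'\<^sup>2 = \<iota> ((8 * q)\<^sup>2) * ev (F_poly a b) X * G * P\<^sup>2 / G ^ 4"
    by (simp add: power_divide power_mult_distrib Y G_def)
  also have "(8 * q)\<^sup>2 = 64 * b" by (simp add: power_mult_distrib q)
  also have "\<iota> (64 * b) * ev (F_poly a b) X * P\<^sup>2
      = \<iota> (b ^ 3) * G ^ 3 + \<iota> (81 - 2 * b ^ 3) * ev N X * G\<^sup>2 + \<iota> (b ^ 3 - 18) * (ev N X)\<^sup>2 * G
        + (ev N X) ^ 3"
    using a unfolding G_def P_def G_poly_def F_poly_def N_def by simp algebra
  then have "\<iota> (64 * b) * ev (F_poly a b) X * G * P\<^sup>2 / G ^ 4
      = ev [:b ^ 3, 81 - 2 * b ^ 3, b ^ 3 - 18, 1:] U'"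
    using \<open>G \<noteq> 0\<close> by (simp add: U'_def field_simps eval_nat_numeral)
  finally have V': "V'\<^sup>2 = ev [:b ^ 3, 81 - 2 * b ^ 3, b ^ 3 - 18, 1:] U'" .
  have "poly (G_poly b) (- 3 / b) = 4 * (b ^ 3 - 27) / b ^ 3"
    using \<open>b \<noteq> 0\<close> by (simp add: G_poly_def field_simps eval_nat_numeral)
  then have U'': "transcendental_over \<iota> U'"
    using assms \<open>G \<noteq> 0\<close>
    by (intro transcendental_quotient[OF X, where M = "G_poly b" and N = N and e = "- 3 / b"])
      (auto simp: U'_def G_def N_def simp del: ev_pCons)
  let ?A = "81 * (81 - 2 * b ^ 3) - 27 * (b ^ 3 - 18)\<^sup>2"
    and ?B = "729 * b ^ 3 - 243 * (81 - 2 * b ^ 3) * (b ^ 3 - 18) + 54 * (b ^ 3 - 18) ^ 3"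
  \<comment> \<open>In b alone this is -27 ((b^3 + 9)^2 - 48 b^3), and b^3 + 9 = 4ab.\<close>
  have A: "?A = - 432 * (a\<^sup>2 - 3 * b) * b\<^sup>2" using H by algebra
  have disc: "4 * ?A ^ 3 + 27 * ?B\<^sup>2 = 2176782336 * D * b ^ 6" using H unfolding D by algebra
  have nz: "4 * ?A ^ 3 + 27 * ?B\<^sup>2 \<noteq> 0"
    unfolding disc using \<open>D \<noteq> 0\<close> \<open>b \<noteq> 0\<close> by simp
  have "j_invariant \<iota> (adjoin \<iota> {U', V'}) = 1728 * (4 * ?A ^ 3) / (4 * ?A ^ 3 + 27 * ?B\<^sup>2)"
    by (rule j_invariant_cubic[OF U'' V' _ _ nz]) simp_all
  also have "\<dots> = 1728 * (4 * (- 432 * (a\<^sup>2 - 3 * b) * b\<^sup>2) ^ 3) / (2176782336 * D * b ^ 6)"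
    unfolding disc unfolding A ..
  also have "\<dots> = - 256 * (a\<^sup>2 - 3 * b) ^ 3 / D"
    using \<open>b \<noteq> 0\<close> unfolding power_mult_distrib by simp
  also have "adjoin \<iota> {U', V'} = adjoin \<iota> {U, V}"
    unfolding U' V'_def using \<open>b \<noteq> 0\<close> by (intro adjoin_affine) auto
  also have "adjoin \<iota> {U, V} = E2 \<iota> a b r q X Y"
    using H unfolding E2_def Let_def U_def V_def G_def P_def by simp
  finally show ?thesis .
qed

end

text \<open>The bracket is the numerator of the difference of the two j-invariants, up to the factor
  16. With a = u/b its ingredients are polynomials in u and v divided by a power of b: b for the
  first cubed factor, b^2 for \<open>a^2 - 3 b\<close> and b^3 for the last factor. Either summand
  therefore needs at most b^9 = v^3.\<close>

lemma equal_j_factorization: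
  fixes a b :: "'a::idom"
  defines "u \<equiv> a * b" and "v \<equiv> b ^ 3"
  shows "b ^ 9 * ((a\<^sup>2 * b ^ 4 + 216 * a\<^sup>2 * b - 126 * a * b ^ 3 - 972 * a + 12 * b ^ 5 + 405 * b\<^sup>2) ^ 3
        + 16 * (a\<^sup>2 - 3 * b) ^ 3 * (b ^ 3 - 27) ^ 3 * (4 * a ^ 3 + 27 - 18 * a * b - a\<^sup>2 * b\<^sup>2 + 4 * b ^ 3))
    = (8 * v ^ 3 + 27 * v ^ 2 - 54 * u * v ^ 2 - u ^ 2 * v ^ 2 + 108 * u ^ 2 * v
           + 4 * u ^ 3 * v - 108 * u ^ 3)
      * (324 * v ^ 4 * u ^ 2 - 5832 * v ^ 4 * u + 37908 * v ^ 4 - 314928 * v ^ 3 * u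
           - 81 * v ^ 3 * u ^ 4 + 255879 * v ^ 3 + 30618 * v ^ 3 * u ^ 2
           - 864 * v ^ 3 * u ^ 3 - 6377292 * u * v ^ 2 + 8503056 * v ^ 2
           - 324 * u ^ 5 * v ^ 2 + 2125764 * u ^ 2 * v ^ 2 - 215784 * u ^ 3 * v ^ 2
           + 14580 * u ^ 4 * v ^ 2 + 16 * u ^ 6 * v ^ 2 + 78732 * u ^ 3 * v
           + 8748 * u ^ 5 * v - 864 * u ^ 6 * v - 157464 * u ^ 4 * v + 11664 * u ^ 6)"
  unfolding u_def v_def by algebra

theorem mainTheorem10:
  fixes \<iota> :: "'k::{alg_closed_field, field_char_0} \<Rightarrow> 'f::field"
    and a b r q u v :: 'k and X Y :: 'f and K :: "'f set"
  assumes emb: "field_embedding \<iota>"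
    and nondeg: "(4 * a ^ 3 + 27 - 18 * a * b - a ^ 2 * b ^ 2 + 4 * b ^ 3) * (b ^ 3 - 27) \<noteq> 0"
    and X: "transcendental_over \<iota> X"
    and Y: "Y ^ 2 = eval_at \<iota> (F_poly a b) X * eval_at \<iota> (G_poly b) X"
    and K: "K = adjoin \<iota> {X, Y}"
    and r: "r ^ 2 = 27 - b ^ 3"
    and q: "q ^ 2 = b"
    and u: "u = a * b"
    and v: "v = b ^ 3"
    and v_nz: "v \<noteq> 0"
    and iso: "j_invariant \<iota> (E1 \<iota> a b X Y) = j_invariant \<iota> (E2 \<iota> a b r q X Y)"
  shows "8 * v ^ 3 + 27 * v ^ 2 - 54 * u * v ^ 2 - u ^ 2 * v ^ 2 + 108 * u ^ 2 * v
           + 4 * u ^ 3 * v - 108 * u ^ 3 = 0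
       \<or> 324 * v ^ 4 * u ^ 2 - 5832 * v ^ 4 * u + 37908 * v ^ 4 - 314928 * v ^ 3 * u
           - 81 * v ^ 3 * u ^ 4 + 255879 * v ^ 3 + 30618 * v ^ 3 * u ^ 2
           - 864 * v ^ 3 * u ^ 3 - 6377292 * u * v ^ 2 + 8503056 * v ^ 2
           - 324 * u ^ 5 * v ^ 2 + 2125764 * u ^ 2 * v ^ 2 - 215784 * u ^ 3 * v ^ 2
           + 14580 * u ^ 4 * v ^ 2 + 16 * u ^ 6 * v ^ 2 + 78732 * u ^ 3 * v
           + 8748 * u ^ 5 * v - 864 * u ^ 6 * v - 157464 * u ^ 4 * v + 11664 * u ^ 6 = 0"
proof -
  interpret embedded_field \<iota> by (rule embedded_field.intro) (rule emb)
  let ?D = "4 * a ^ 3 + 27 - 18 * a * b - a\<^sup>2 * b\<^sup>2 + 4 * b ^ 3"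
  let ?Q = "a\<^sup>2 * b ^ 4 + 216 * a\<^sup>2 * b - 126 * a * b ^ 3 - 972 * a + 12 * b ^ 5 + 405 * b\<^sup>2"
  have b: "b \<noteq> 0" using v v_nz by auto
  have D: "?D \<noteq> 0" and w: "b ^ 3 - 27 \<noteq> 0" using nondeg by auto
  have "j_invariant \<iota> (E2 \<iota> a b r q X Y) = - 256 * (a\<^sup>2 - 3 * b) ^ 3 / ?D"
  proof (cases "b ^ 3 - 4 * a * b + 9 = 0")
    case True
    then show ?thesis by (rule j_invariant_E2_degenerate[OF X Y refl D w b q])
  next
    case False
    then show ?thesis by (rule j_invariant_E2_generic[OF X Y refl D refl w b r refl])
  qed
  with iso j_invariant_E1[OF X Y refl D w]
  have "16 * ?Q ^ 3 / ((b ^ 3 - 27) ^ 3 * ?D\<^sup>2) = - 256 * (a\<^sup>2 - 3 * b) ^ 3 / ?D"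
    by simp
  then have "16 * ?Q ^ 3 * ?D = - 256 * (a\<^sup>2 - 3 * b) ^ 3 * ((b ^ 3 - 27) ^ 3 * ?D\<^sup>2)"
    using D w by (subst (asm) frac_eq_eq) auto
  then have "16 * ?D * (?Q ^ 3 + 16 * (a\<^sup>2 - 3 * b) ^ 3 * (b ^ 3 - 27) ^ 3 * ?D) = 0"
    by algebra
  then have "?Q ^ 3 + 16 * (a\<^sup>2 - 3 * b) ^ 3 * (b ^ 3 - 27) ^ 3 * ?D = 0"
    using D by (simp only: mult_eq_0_iff) simp
  then show ?thesis
    using equal_j_factorization[of b a] unfolding u v by (simp only: mult_zero_right) (metis mult_eq_0_iff)
qed

end
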